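(* Let $W$ be a finite Coxeter group and let $H$ be a parabolic reflection subgroup of $W$. Then $H$ is a modular subgroup of $W$ if and only if $V_H$ is a modular element of the geometric lattice $\mathcal{L}_W$.
   Context: $(W,S)$ is a Coxeter system with $W$ finite, $T = \{wsw^{-1} : w \in W, s\in S\}$ is the set of reflections, and $\ell_T(w)$ is the minimum $k$ such that $w$ is a product of $k$ elements of $T$. The absolute order $\mathrm{Abs}(W) = (W,\le_T)$ is defined by $u \le_T v$ iff $\ell_T(vu^{-1}) = \ell_T(v) - \ell_T(u)$. A subgroup $H$ of $W$ is modular if every left coset of $H$ in $W$ has a minimum element in $\mathrm{Abs}(W)$. A reflection subgroup of $W$ is a subgroup generated by reflections (elements of $T$); it is parabolic if it is conjugate to a subgroup generated by a subset of $S$. $W$ acts faithfully on a finite-dimensional Euclidean space $V$ by its standard geometric representation, as a group of orthogonal transformations generated by reflections; $\Phi \subset V$ is a corresponding root system, $t_\alpha$ is the orthogonal reflection in the hyperplane orthogonal to $\alpha \in \Phi$, and $T = \{t_\alpha : \alpha \in \Phi\}$. $\mathcal{L}_W$ is the geometric lattice of all linear subspaces of $V$ spanned by subsets of $\Phi$, partially ordered by inclusion; its rank function is the dimension. For a reflection subgroup $H$, $V_H \in \mathcal{L}_W$ is the linear span of all $\alpha \in \Phi$ with $t_\alpha \in H$. An element $Z$ of a geometric lattice $\mathcal{L}$ with rank function $\mathrm{rk}$ is modular if $\mathrm{rk}(Y) + \mathrm{rk}(Z) = \mathrm{rk}(Y \wedge Z) + \mathrm{rk}(Y \vee Z)$ for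 every $Y \in \mathcal{L}$. *)

theory Defs
  imports
    "HOL-Analysis.Analysis"
    "HOL-Algebra.Generated_Groups"
    "HOL-Algebra.Multiplicative_Group"
    "HOL-Algebra.Group_Action"
    "HOL-Algebra.Left_Coset"
    "HOL-Algebra.Lattice"
begin

section \<open>Coxeter systems\<close>

definition word_prod :: "('a, 'b) monoid_scheme \<Rightarrow> 'a list \<Rightarrow> 'a"
  where "word_prod G xs = foldr (mult G) xs \<one>\<^bsub>G\<^esub>"

text \<open>
  Deletion of one relator \<open>(st)\<^sup>m\<close>, where \<open>m\<close> is the order of \<open>st\<close>, from a word. The case
  \<open>s = t\<close> is the relator \<open>ss\<close>. If \<open>st\<close> has infinite order then \<open>group.ord\<close> is \<open>0\<close> and the
  relator is the empty word, that is, there is no relation.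
\<close>

inductive relator_deletion :: "('a, 'b) monoid_scheme \<Rightarrow> 'a set \<Rightarrow> 'a list \<Rightarrow> 'a list \<Rightarrow> bool"
  for W S where
  "\<lbrakk>s \<in> S; t \<in> S\<rbrakk> \<Longrightarrow>
     relator_deletion W S
       (us @ concat (replicate (group.ord W (s \<otimes>\<^bsub>W\<^esub> t)) [s, t]) @ vs) (us @ vs)"

text \<open>
  \<open>W\<close> has the presentation with generators \<open>S\<close> and relations \<open>(st)\<^sup>m = 1\<close>. The relators
  \<open>ss\<close> make formal inverses superfluous, so words in \<open>S\<close> suffice.
\<close>

definition coxeter_system :: "('a, 'b) monoid_scheme \<Rightarrow> 'a set \<Rightarrow> bool"
  where "coxeter_system W S \<longleftrightarrow>
    group W \<and> S \<subseteq> carrier W \<and> generate W S = carrier W \<and>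
    (\<forall>s\<in>S. group.ord W s = 2) \<and>
    (\<forall>xs\<in>lists S. word_prod W xs = \<one>\<^bsub>W\<^esub> \<longrightarrow> equivclp (relator_deletion W S) xs [])"

definition reflections :: "('a, 'b) monoid_scheme \<Rightarrow> 'a set \<Rightarrow> 'a set"
  where "reflections W S = {w \<otimes>\<^bsub>W\<^esub> s \<otimes>\<^bsub>W\<^esub> inv\<^bsub>W\<^esub> w | w s. w \<in> carrier W \<and> s \<in> S}"

definition reflection_length :: "('a, 'b) monoid_scheme \<Rightarrow> 'a set \<Rightarrow> 'a \<Rightarrow> nat"
  where "reflection_length W S w =
    (LEAST k. \<exists>xs\<in>lists (reflections W S). length xs = k \<and> word_prod W xs = w)"

definition absolute_le :: "('a, 'b) monoid_scheme \<Rightarrow> 'a set \<Rightarrow> 'a \<Rightarrow> 'a \<Rightarrow> bool"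
  where "absolute_le W S u v \<longleftrightarrow>
    int (reflection_length W S (v \<otimes>\<^bsub>W\<^esub> inv\<^bsub>W\<^esub> u)) =
      int (reflection_length W S v) - int (reflection_length W S u)"

definition modular_subgroup :: "('a, 'b) monoid_scheme \<Rightarrow> 'a set \<Rightarrow> 'a set \<Rightarrow> bool"
  where "modular_subgroup W S H \<longleftrightarrow>
    subgroup H W \<and> (\<forall>C\<in>lcosets\<^bsub>W\<^esub> H. \<exists>m\<in>C. \<forall>x\<in>C. absolute_le W S m x)"

definition reflection_subgroup :: "('a, 'b) monoid_scheme \<Rightarrow> 'a set \<Rightarrow> 'a set \<Rightarrow> bool"
  where "reflection_subgroup W S H \<longleftrightarrow> (\<exists>R \<subseteq> reflections W S. H = generate W R)"

definition parabolic :: "('a, 'b) monoid_scheme \<Rightarrow> 'a set \<Rightarrow> 'a set \<Rightarrow> bool"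
  where "parabolic W S H \<longleftrightarrow>
    (\<exists>w\<in>carrier W. \<exists>J \<subseteq> S. H = w <#\<^bsub>W\<^esub> generate W J #>\<^bsub>W\<^esub> inv\<^bsub>W\<^esub> w)"


section \<open>The geometric representation and root systems\<close>

text \<open>
  The Euclidean space of the representation is a subspace \<open>V\<close> of a type of class
  \<^class>\<open>euclidean_space\<close>; as such a type has positive dimension, taking \<open>V = UNIV\<close> throughout
  would exclude the trivial group. Transformations of \<open>V\<close> are elements of \<^term>\<open>BijGroup V\<close>
  and hence extensional.
\<close>

definition reflection :: "'v::euclidean_space \<Rightarrow> 'v \<Rightarrow> 'v"
  where "reflection \<alpha> x = x - (2 * (x \<bullet> \<alpha>) / (\<alpha> \<bullet> \<alpha>)) *\<^sub>R \<alpha>"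

definition reflection_on :: "'v::euclidean_space set \<Rightarrow> 'v \<Rightarrow> 'v \<Rightarrow> 'v"
  where "reflection_on V \<alpha> = restrict (reflection \<alpha>) V"

text \<open>
  \<open>e s\<close> is the unit simple root of \<open>s\<close>. The inner product is the canonical bilinear form of the
  Coxeter group; for \<open>s = t\<close> the formula gives \<open>e s \<bullet> e s = 1\<close>. Linearity and orthogonality of
  the transformations \<open>\<rho> w\<close> follow, as \<open>S\<close> generates \<open>W\<close>.
\<close>

definition geometric_representation ::
  "('a, 'b) monoid_scheme \<Rightarrow> 'a set \<Rightarrow> 'v::euclidean_space set \<Rightarrow> ('a \<Rightarrow> 'v) \<Rightarrow> ('a \<Rightarrow> 'v \<Rightarrow> 'v) \<Rightarrow> bool"
  where "geometric_representation W S V e \<rho> \<longleftrightarrow>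
    inj_on e S \<and> independent (e ` S) \<and> span (e ` S) = V \<and>
    (\<forall>s\<in>S. \<forall>t\<in>S. e s \<bullet> e t = - cos (pi / real (group.ord W (s \<otimes>\<^bsub>W\<^esub> t)))) \<and>
    faithful_action W V \<rho> \<and>
    (\<forall>s\<in>S. \<rho> s = reflection_on V (e s))"

definition root_system :: "'v::euclidean_space set \<Rightarrow> bool"
  where "root_system \<Phi> \<longleftrightarrow>
    finite \<Phi> \<and> 0 \<notin> \<Phi> \<and>
    (\<forall>\<alpha>\<in>\<Phi>. \<Phi> \<inter> span {\<alpha>} = {\<alpha>, - \<alpha>} \<and> reflection \<alpha> ` \<Phi> = \<Phi>)"

definition root_system_of ::
  "('a, 'b) monoid_scheme \<Rightarrow> 'a set \<Rightarrow> 'v::euclidean_space set \<Rightarrow> ('a \<Rightarrow> 'v \<Rightarrow> 'v) \<Rightarrow> 'v set \<Rightarrow> bool"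
  where "root_system_of W S V \<rho> \<Phi> \<longleftrightarrow>
    root_system \<Phi> \<and> \<Phi> \<subseteq> V \<and> reflection_on V ` \<Phi> = \<rho> ` reflections W S"

definition root_span ::
  "'v::euclidean_space set \<Rightarrow> ('a \<Rightarrow> 'v \<Rightarrow> 'v) \<Rightarrow> 'v set \<Rightarrow> 'a set \<Rightarrow> 'v set"
  where "root_span V \<rho> \<Phi> H = span {\<alpha>\<in>\<Phi>. reflection_on V \<alpha> \<in> \<rho> ` H}"


section \<open>The lattice of root subspaces\<close>

definition root_lattice :: "'v::euclidean_space set \<Rightarrow> 'v set gorder"
  where "root_lattice \<Phi> = \<lparr>carrier = {span A | A. A \<subseteq> \<Phi>}, eq = (=), le = (\<subseteq>)\<rparr>"

definition modular_element :: "('c, 'd) gorder_scheme \<Rightarrow> ('c \<Rightarrow> nat) \<Rightarrow> 'c \<Rightarrow> bool"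
  where "modular_element L rk Z \<longleftrightarrow>
    Z \<in> carrier L \<and>
    (\<forall>Y\<in>carrier L. rk Y + rk Z = rk (Y \<sqinter>\<^bsub>L\<^esub> Z) + rk (Y \<squnion>\<^bsub>L\<^esub> Z))"

text \<open>
  The join is the sum of subspaces, but the meet is in general smaller than the intersection.
\<close>

lemma partial_order_root_lattice: "partial_order (root_lattice \<Phi>)"
  by standard (auto simp: root_lattice_def)

lemma least_join_root_lattice:
  assumes "Y \<in> carrier (root_lattice \<Phi>)" "Z \<in> carrier (root_lattice \<Phi>)"
  shows "least (root_lattice \<Phi>) (span (Y \<union> Z)) (Upper (root_lattice \<Phi>) {Y, Z})"
proof -
  obtain A B where AB: "A \<subseteq> \<Phi>" "B \<subseteq> \<Phi>" "Y = span A" "Z = span B"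
    using assms unfolding root_lattice_def by auto
  have "span (Y \<union> Z) = span (A \<union> B)"
    unfolding AB by (simp only: span_Un span_span)
  moreover have "A \<union> B \<subseteq> \<Phi>" using AB by blast
  ultimately have mem: "span (Y \<union> Z) \<in> carrier (root_lattice \<Phi>)"
    unfolding root_lattice_def by auto
  have ub: "Y \<subseteq> span (Y \<union> Z)" "Z \<subseteq> span (Y \<union> Z)"
    using span_superset[of "Y \<union> Z"] by blast+
  have le: "le (root_lattice \<Phi>) = (\<subseteq>)" by (simp add: root_lattice_def)
  have "span (Y \<union> Z) \<subseteq> U"
    if "U \<in> carrier (root_lattice \<Phi>)" "Y \<subseteq> U" "Z \<subseteq> U" for U
  proof (rule span_minimal)
    show "subspace U" using that(1) unfolding root_lattice_def by auto
    show "Y \<union> Z \<subseteq> U" using that by blast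
  qed
  note least = this
  show ?thesis
    unfolding least_def
  proof (intro conjI ballI)
    show "Upper (root_lattice \<Phi>) {Y, Z} \<subseteq> carrier (root_lattice \<Phi>)"
      by (rule Upper_closed)
    show "span (Y \<union> Z) \<in> Upper (root_lattice \<Phi>) {Y, Z}"
      unfolding Upper_def le using mem ub by fastforce
    fix U assume "U \<in> Upper (root_lattice \<Phi>) {Y, Z}"
    then have "U \<in> carrier (root_lattice \<Phi>)" "Y \<subseteq> U" "Z \<subseteq> U"
      using assms unfolding Upper_def le by simp_all
    then show "le (root_lattice \<Phi>) (span (Y \<union> Z)) U"
      unfolding le by (rule least)
  qed
qed

lemma greatest_meet_root_lattice:
  assumes "Y \<in> carrier (root_lattice \<Phi>)" "Z \<in> carrier (root_lattice \<Phi>)"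
  shows "greatest (root_lattice \<Phi>) (span (\<Phi> \<inter> Y \<inter> Z)) (Lower (root_lattice \<Phi>) {Y, Z})"
proof -
  have sub: "subspace Y" "subspace Z"
    using assms unfolding root_lattice_def by auto
  have lb: "span (\<Phi> \<inter> Y \<inter> Z) \<subseteq> Y" "span (\<Phi> \<inter> Y \<inter> Z) \<subseteq> Z"
    using sub by (intro span_minimal; blast)+
  have mem: "span (\<Phi> \<inter> Y \<inter> Z) \<in> carrier (root_lattice \<Phi>)"
    unfolding root_lattice_def by auto
  have le: "le (root_lattice \<Phi>) = (\<subseteq>)" by (simp add: root_lattice_def)
  have "U \<subseteq> span (\<Phi> \<inter> Y \<inter> Z)"
    if U: "U \<in> carrier (root_lattice \<Phi>)" "U \<subseteq> Y" "U \<subseteq> Z" for U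
  proof -
    obtain C where C: "C \<subseteq> \<Phi>" "U = span C"
      using U(1) unfolding root_lattice_def by auto
    have "C \<subseteq> \<Phi> \<inter> Y \<inter> Z"
      using C U span_superset[of C] by blast
    then show ?thesis unfolding C(2) by (rule span_mono)
  qed
  note greatest = this
  show ?thesis
    unfolding greatest_def
  proof (intro conjI ballI)
    show "Lower (root_lattice \<Phi>) {Y, Z} \<subseteq> carrier (root_lattice \<Phi>)"
      by (rule Lower_closed)
    show "span (\<Phi> \<inter> Y \<inter> Z) \<in> Lower (root_lattice \<Phi>) {Y, Z}"
      unfolding Lower_def le using mem lb by fastforce
    fix U assume "U \<in> Lower (root_lattice \<Phi>) {Y, Z}"
    then have "U \<in> carrier (root_lattice \<Phi>)" "U \<subseteq> Y" "U \<subseteq> Z"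
      using assms unfolding Lower_def le by simp_all
    then show "le (root_lattice \<Phi>) U (span (\<Phi> \<inter> Y \<inter> Z))"
      unfolding le by (rule greatest)
  qed
qed

lemma lattice_root_lattice: "lattice (root_lattice \<Phi>)"
proof -
  interpret partial_order "root_lattice \<Phi>" by (rule partial_order_root_lattice)
  show ?thesis
    by standard (blast intro: least_join_root_lattice greatest_meet_root_lattice)+
qed

end

theory Submission
  imports Defs
begin

text \<open>
  For \<open>w \<in> W\<close> let \<open>M w\<close> be the image of \<open>w - 1\<close>, the orthogonal complement of the fixed space.
  By Carter's lemma the reflection length of \<open>w\<close> is \<open>dim (M w)\<close>; this needs that \<open>M w\<close> contains a
  root whenever \<open>w \<noteq> 1\<close>, which follows from Tits' description of the stabilizers of points in the
  fundamental chamber, applied to a generic fixed point of \<open>w\<close>. The same description shows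
  that a parabolic \<open>H\<close> consists of all \<open>h\<close> with \<open>M h \<subseteq> V\<^sub>H\<close>. As lengths add in \<open>m h\<close> if and only if
  \<open>M m \<inter> M h = 0\<close>, and \<open>V\<^sub>H = M c\<close> for some \<open>c \<in> H\<close>, the element \<open>m\<close> is the minimum of \<open>m H\<close> if and
  only if \<open>M m \<inter> V\<^sub>H = 0\<close>. On the other side, \<open>V\<^sub>H\<close> is modular if and only if \<open>Y \<inter> V\<^sub>H\<close> is spanned by
  roots for every \<open>Y\<close> in the lattice. If this holds and \<open>m\<close> has minimal length in its coset, then a
  root \<open>\<alpha>\<close> in \<open>M m \<inter> V\<^sub>H\<close> would make \<open>m t\<^sub>\<alpha>\<close> shorter, so \<open>M m \<inter> V\<^sub>H = 0\<close>. Conversely, write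
  \<open>Y = M w\<close> and \<open>w = m h\<close> with \<open>m\<close> the minimum of \<open>w H\<close>; then \<open>Y = M m \<oplus> M h\<close> and \<open>Y \<inter> V\<^sub>H = M h\<close>,
  which is spanned by roots.
\<close>

section \<open>Reflections and moved spaces\<close>

lemma orthogonal_transformation_reflection: "orthogonal_transformation (reflection \<alpha>)"
proof -
  have "linear (reflection \<alpha>)"
    by (rule linearI)
      (simp_all add: reflection_def inner_add_left algebra_simps add_divide_distrib scaleR_add_left)
  moreover have "reflection \<alpha> v \<bullet> reflection \<alpha> w = v \<bullet> w" for v w
    by (cases "\<alpha> = 0")
      (simp_all add: reflection_def algebra_simps inner_diff_left inner_diff_right inner_commute)
  ultimately show ?thesis
    by (simp add: orthogonal_transformation_def)
qed

lemma reflection_eq_iff: "\<alpha> \<noteq> 0 \<Longrightarrow> reflection \<alpha> x = x \<longleftrightarrow> x \<bullet> \<alpha> = 0"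
  by (simp add: reflection_def)

lemma reflection_involution [simp]: "reflection \<alpha> (reflection \<alpha> x) = x"
  by (cases "\<alpha> = 0") (simp_all add: reflection_def inner_diff_left algebra_simps)

lemma reflection_self: "reflection \<alpha> \<alpha> = - \<alpha>"
  by (cases "\<alpha> = 0") (simp_all add: reflection_def scaleR_2)

lemma reflection_conj:
  assumes "orthogonal_transformation f"
  shows "f (reflection \<alpha> x) = reflection (f \<alpha>) (f x)"
proof -
  have "linear f" "\<And>v w. f v \<bullet> f w = v \<bullet> w"
    using assms by (auto simp: orthogonal_transformation_def)
  then show ?thesis
    by (simp add: reflection_def linear_diff linear_scale)
qed

definition moved_space :: "('v::euclidean_space \<Rightarrow> 'v) \<Rightarrow> 'v set"
  where "moved_space f = range (\<lambda>x. f x - x)"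

lemma subspace_moved_space:
  assumes "linear f"
  shows "subspace (moved_space f)"
  unfolding moved_space_def
  by (intro linear_subspace_image linear_compose_sub assms linear_ident subspace_UNIV)

lemma moved_space_id: "moved_space (\<lambda>x. x) = {0}"
  by (auto simp: moved_space_def)

text \<open>If \<open>x\<close> is fixed, then
  \<open>x \<bullet> f y = f x \<bullet> f y = x \<bullet> y\<close>. Conversely, only
  \<open>y = f x - x\<close> matters: as \<open>f\<close> preserves norms, the squared norm of
  \<open>f x - x\<close> is \<open>- 2 * (x \<bullet> (f x - x))\<close>.\<close>

lemma orthogonal_transformation_fixed_iff:
  assumes "orthogonal_transformation f"
  shows "f x = x \<longleftrightarrow> (\<forall>y\<in>moved_space f. x \<bullet> y = 0)"
proof -
  have f: "\<And>v w. f v \<bullet> f w = v \<bullet> w"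
    using assms by (auto simp: orthogonal_transformation_def)
  show ?thesis
  proof
    assume x: "f x = x"
    have "x \<bullet> (f y - y) = 0" for y
      using f[of x y] x by (simp add: inner_diff_right)
    then show "\<forall>y\<in>moved_space f. x \<bullet> y = 0"
      by (auto simp: moved_space_def)
  next
    assume "\<forall>y\<in>moved_space f. x \<bullet> y = 0"
    then have "x \<bullet> (f x - x) = 0"
      by (auto simp: moved_space_def)
    then have "(f x - x) \<bullet> (f x - x) = 0"
      using f[of x x] by (simp add: inner_diff_right inner_diff_left inner_commute)
    then show "f x = x"
      by simp
  qed
qed

text \<open>For the converse, split \<open>y = a + b\<close> along the moved space and its
  complement. The part \<open>b\<close> is fixed, hence orthogonal to \<open>y\<close> and to
  \<open>a\<close>, hence to itself.\<close>

lemma moved_space_iff: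
  assumes "orthogonal_transformation f"
  shows "y \<in> moved_space f \<longleftrightarrow> (\<forall>x. f x = x \<longrightarrow> x \<bullet> y = 0)"
proof
  assume "y \<in> moved_space f"
  then show "\<forall>x. f x = x \<longrightarrow> x \<bullet> y = 0"
    using orthogonal_transformation_fixed_iff[OF assms] by blast
next
  assume y: "\<forall>x. f x = x \<longrightarrow> x \<bullet> y = 0"
  have sp: "span (moved_space f) = moved_space f"
    using assms by (simp add: subspace_moved_space orthogonal_transformation_linear span_eq_iff)
  obtain a b where ab: "a \<in> moved_space f" "\<And>w. w \<in> moved_space f \<Longrightarrow> orthogonal b w" "y = a + b"
    using orthogonal_subspace_decomp_exists[of "moved_space f" y] unfolding sp by blast
  then have "f b = b"
    by (simp add: orthogonal_transformation_fixed_iff[OF assms] orthogonal_def)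
  then have "b \<bullet> y = 0" "b \<bullet> a = 0"
    using y ab by (auto simp: orthogonal_def)
  then have "b = 0"
    using ab(3) by (simp add: inner_add_right)
  then show "y \<in> moved_space f"
    using ab by simp
qed

lemma moved_space_comp_subset:
  "moved_space (f \<circ> h) \<subseteq> {a + b | a b. a \<in> moved_space f \<and> b \<in> moved_space h}"
proof
  fix y assume "y \<in> moved_space (f \<circ> h)"
  then obtain x where "y = f (h x) - x"
    by (auto simp: moved_space_def)
  then have "y = (f (h x) - h x) + (h x - x)"
    by simp
  then show "y \<in> {a + b | a b. a \<in> moved_space f \<and> b \<in> moved_space h}"
    unfolding moved_space_def by blast
qed

text \<open>If the moved spaces meet only in \<open>0\<close>, every fixed point of the composite is
  fixed by both factors. Passing to orthogonal complements turns this into the sum of the moved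
  spaces.\<close>

lemma moved_space_comp_disjoint:
  assumes f: "orthogonal_transformation f" and h: "orthogonal_transformation h"
    and disj: "moved_space f \<inter> moved_space h = {0}"
  shows "moved_space (f \<circ> h) = {a + b | a b. a \<in> moved_space f \<and> b \<in> moved_space h}"
proof (rule antisym[OF moved_space_comp_subset], clarify)
  fix a b assume a: "a \<in> moved_space f" and b: "b \<in> moved_space h"
  have fixed: "f x = x \<and> h x = x" if "(f \<circ> h) x = x" for x
  proof -
    \<comment> \<open>The displacement of \<open>x\<close> by \<open>h\<close> is undone by
      \<open>f\<close>, so it lies in both moved spaces.\<close>
    have "h x - x = - (f (h x) - h x)"
      using that by simp
    moreover have "f (h x) - h x \<in> moved_space f"
      by (auto simp: moved_space_def)
    ultimately have "h x - x \<in> moved_space f"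
      using subspace_neg[OF subspace_moved_space[OF orthogonal_transformation_linear[OF f]]] by metis
    moreover have "h x - x \<in> moved_space h"
      by (auto simp: moved_space_def)
    ultimately have "h x - x = 0"
      using disj by blast
    with that show ?thesis by simp
  qed
  have "x \<bullet> (a + b) = 0" if "(f \<circ> h) x = x" for x
    using fixed[OF that] a b
    by (simp add: moved_space_iff[OF f] moved_space_iff[OF h] inner_add_right)
  then show "a + b \<in> moved_space (f \<circ> h)"
    by (simp add: moved_space_iff[OF orthogonal_transformation_compose[OF f h]] del: comp_apply)
qed

text \<open>The dimension formula for the sum of the two moved spaces. The intersection is kept on
  the left so that additivity of dimensions later forces it to be zero.\<close>

lemma dim_moved_space_comp_le:
  assumes f: "orthogonal_transformation f" and h: "orthogonal_transformation h"
  shows "dim (moved_space (f \<circ> h)) + dim (moved_space f \<inter> moved_space h)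
    \<le> dim (moved_space f) + dim (moved_space h)"
proof -
  have "dim (moved_space (f \<circ> h)) \<le> dim {a + b | a b. a \<in> moved_space f \<and> b \<in> moved_space h}"
    by (rule dim_subset[OF moved_space_comp_subset])
  then show ?thesis
    using dim_sums_Int[OF subspace_moved_space subspace_moved_space, of f h] f h
    by (simp add: orthogonal_transformation_linear)
qed

lemma dim_moved_space_comp_disjoint:
  assumes f: "orthogonal_transformation f" and h: "orthogonal_transformation h"
    and disj: "moved_space f \<inter> moved_space h = {0}"
  shows "dim (moved_space (f \<circ> h)) = dim (moved_space f) + dim (moved_space h)"
  using dim_sums_Int[OF subspace_moved_space subspace_moved_space, of f h] f h disj
  by (simp add: orthogonal_transformation_linear moved_space_comp_disjoint)

lemma moved_space_reflection:
  assumes "\<alpha> \<noteq> 0"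
  shows "moved_space (reflection \<alpha>) = span {\<alpha>}"
proof
  show "moved_space (reflection \<alpha>) \<subseteq> span {\<alpha>}"
    by (auto simp: moved_space_def reflection_def simp del: scaleR_minus_left)
      (intro span_neg span_scale span_base, simp)
  have "\<alpha> \<in> moved_space (reflection \<alpha>)"
    using assms by (simp add: moved_space_iff orthogonal_transformation_reflection reflection_eq_iff)
  then show "span {\<alpha>} \<subseteq> moved_space (reflection \<alpha>)"
    by (intro span_minimal subspace_moved_space)
      (simp_all add: orthogonal_transformation_linear orthogonal_transformation_reflection)
qed

lemma moved_space_reflection_disjoint:
  assumes f: "orthogonal_transformation f" and "\<alpha> \<notin> moved_space f"
  shows "moved_space f \<inter> moved_space (reflection \<alpha>) = {0}"
proof -
  have sub: "subspace (moved_space f)"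
    by (simp add: f orthogonal_transformation_linear subspace_moved_space)
  then have "\<alpha> \<noteq> 0"
    using assms(2) subspace_0 by blast
  have "x = 0" if x: "x \<in> moved_space f" "x \<in> span {\<alpha>}" for x
  proof -
    obtain c where c: "x = c *\<^sub>R \<alpha>"
      using x(2) by (auto simp: span_singleton)
    have "c = 0"
    proof (rule ccontr)
      assume "c \<noteq> 0"
      then have "\<alpha> = (1 / c) *\<^sub>R x"
        by (simp add: c)
      then show False
        using subspace_scale[OF sub x(1)] assms(2) by metis
    qed
    then show ?thesis by (simp add: c)
  qed
  then show ?thesis
    using \<open>\<alpha> \<noteq> 0\<close> sub by (auto simp: moved_space_reflection subspace_0 span_0)
qed

lemma moved_space_comp_reflection_notin:
  assumes f: "orthogonal_transformation f" and "\<alpha> \<notin> moved_space f"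
  shows "moved_space (f \<circ> reflection \<alpha>) = span (insert \<alpha> (moved_space f))"
    and "dim (moved_space (f \<circ> reflection \<alpha>)) = Suc (dim (moved_space f))"
proof -
  have sub: "subspace (moved_space f)"
    by (simp add: f orthogonal_transformation_linear subspace_moved_space)
  then have "\<alpha> \<noteq> 0"
    using assms(2) subspace_0 by blast
  have eq: "moved_space (f \<circ> reflection \<alpha>) = {a + b | a b. a \<in> moved_space f \<and> b \<in> span {\<alpha>}}"
    using moved_space_comp_disjoint[OF f orthogonal_transformation_reflection
        moved_space_reflection_disjoint[OF assms]]
    by (simp add: moved_space_reflection[OF \<open>\<alpha> \<noteq> 0\<close>])
  also have "\<dots> = span (moved_space f \<union> {\<alpha>})"
    unfolding span_Un span_eq_iff[THEN iffD2, OF sub] ..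
  finally show *: "moved_space (f \<circ> reflection \<alpha>) = span (insert \<alpha> (moved_space f))"
    by simp
  show "dim (moved_space (f \<circ> reflection \<alpha>)) = Suc (dim (moved_space f))"
    using assms(2) sub by (simp add: * dim_insert span_eq_iff[THEN iffD2])
qed

text \<open>Write \<open>\<alpha> = f v - v\<close>. As \<open>f v\<close> and \<open>v\<close> have
  equal norm, the reflection exchanges them, so \<open>f v\<close> is fixed by the composite. It is
  not orthogonal to \<open>\<alpha>\<close>, so \<open>\<alpha>\<close> has left the moved space,
  and composing with the reflection once more reduces to the previous lemma.\<close>

lemma moved_space_comp_reflection_in:
  assumes f: "orthogonal_transformation f" and \<alpha>: "\<alpha> \<in> moved_space f" "\<alpha> \<noteq> 0"
  shows "Suc (dim (moved_space (f \<circ> reflection \<alpha>))) = dim (moved_space f)"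
    and "moved_space f = span (insert \<alpha> (moved_space (f \<circ> reflection \<alpha>)))"
proof -
  have fr: "orthogonal_transformation (f \<circ> reflection \<alpha>)"
    by (intro orthogonal_transformation_compose f orthogonal_transformation_reflection)
  obtain v where v: "\<alpha> = f v - v"
    using \<alpha>(1) by (auto simp: moved_space_def)
  have "f v \<bullet> f v = v \<bullet> v"
    using f by (auto simp: orthogonal_transformation_def)
  then have fv: "f v \<bullet> \<alpha> = \<alpha> \<bullet> \<alpha> / 2"
    by (simp add: v inner_diff_left inner_diff_right inner_commute)
  then have "2 * (f v \<bullet> \<alpha>) / (\<alpha> \<bullet> \<alpha>) = 1"
    using \<alpha>(2) by simp
  then have "reflection \<alpha> (f v) = f v - \<alpha>"
    by (simp only: reflection_def scaleR_one)
  then have "reflection \<alpha> (f v) = v"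
    by (simp add: v)
  then have "(f \<circ> reflection \<alpha>) (f v) = f v"
    by simp
  moreover have "f v \<bullet> \<alpha> \<noteq> 0"
    using fv \<alpha>(2) by (metis divide_eq_0_iff inner_eq_zero_iff zero_neq_numeral)
  ultimately have notin: "\<alpha> \<notin> moved_space (f \<circ> reflection \<alpha>)"
    unfolding moved_space_iff[OF fr] by blast
  have "f \<circ> reflection \<alpha> \<circ> reflection \<alpha> = f"
    by auto
  then show "moved_space f = span (insert \<alpha> (moved_space (f \<circ> reflection \<alpha>)))"
    and "Suc (dim (moved_space (f \<circ> reflection \<alpha>))) = dim (moved_space f)"
    using moved_space_comp_reflection_notin[OF fr notin] by simp_all
qed

section \<open>Words in a generating set\<close>

text \<open>The letters are a parameter because two lengths are needed: the Coxeter length with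
  letters \<open>S\<close>, and the reflection length.\<close>

definition word_length :: "('a, 'b) monoid_scheme \<Rightarrow> 'a set \<Rightarrow> 'a \<Rightarrow> nat"
  where "word_length G X w = (LEAST k. \<exists>xs\<in>lists X. length xs = k \<and> word_prod G xs = w)"

lemma reflection_length_eq: "reflection_length W S = word_length W (reflections W S)"
  by (simp add: fun_eq_iff reflection_length_def word_length_def)

lemma word_length_le: "xs \<in> lists X \<Longrightarrow> word_length G X (word_prod G xs) \<le> length xs"
  unfolding word_length_def by (rule Least_le) blast

lemma word_length_attained:
  assumes "xs \<in> lists X" and "word_prod G xs = w"
  obtains ys where "ys \<in> lists X" "word_prod G ys = w" "length ys = word_length G X w"
proof -
  have "\<exists>ys\<in>lists X. length ys = word_length G X w \<and> word_prod G ys = w"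
    unfolding word_length_def by (rule LeastI_ex) (use assms in blast)
  then show ?thesis using that by blast
qed

context monoid
begin

lemma word_prod_closed: "set xs \<subseteq> carrier G \<Longrightarrow> word_prod G xs \<in> carrier G"
  by (induction xs) (auto simp: word_prod_def)

lemma word_prod_Nil [simp]: "word_prod G [] = \<one>"
  by (simp add: word_prod_def)

lemma word_prod_Cons [simp]: "word_prod G (x # xs) = x \<otimes> word_prod G xs"
  by (simp add: word_prod_def)

lemma word_prod_append:
  "\<lbrakk>set xs \<subseteq> carrier G; set ys \<subseteq> carrier G\<rbrakk>
    \<Longrightarrow> word_prod G (xs @ ys) = word_prod G xs \<otimes> word_prod G ys"
  by (induction xs) (auto simp: word_prod_closed m_assoc)

end

lemma (in group) generate_word:
  assumes "X \<subseteq> carrier G" and "\<And>x. x \<in> X \<Longrightarrow> inv x \<in> X" and "w \<in> generate G X"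
  obtains xs where "xs \<in> lists X" "word_prod G xs = w"
proof -
  have "\<exists>xs\<in>lists X. word_prod G xs = w"
    using assms(3)
  proof induction
    case one
    show ?case by (intro bexI[of _ "[]"]) auto
  next
    case (incl h)
    then show ?case using assms(1) by (intro bexI[of _ "[h]"]) auto
  next
    case (inv h)
    then show ?case using assms(1,2) by (intro bexI[of _ "[inv h]"]) auto
  next
    case (eng h1 h2)
    then obtain xs ys where "xs \<in> lists X" "word_prod G xs = h1" "ys \<in> lists X" "word_prod G ys = h2"
      by blast
    moreover from this have "word_prod G (xs @ ys) = h1 \<otimes> h2"
      using assms(1) by (subst word_prod_append) auto
    ultimately show ?case by (intro bexI[of _ "xs @ ys"]) auto
  qed
  then show ?thesis using that by blast
qed

section \<open>Chambers\<close>

text \<open>The group acts by orthogonal maps of the whole ambient type, so that composition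
  involves no restriction to \<open>V\<close>. The assumption \<open>dual_vector\<close>, for
  arbitrary \<open>f\<close>, is the form in which independence of the simple roots is used.\<close>

locale finite_coxeter_action = group W for W (structure) +
  fixes S :: "'a set" and e :: "'a \<Rightarrow> 'v::euclidean_space" and g :: "'a \<Rightarrow> 'v \<Rightarrow> 'v"
  assumes finite_carrier: "finite (carrier W)"
    and S_subset: "S \<subseteq> carrier W"
    and generate_S: "generate W S = carrier W"
    and S_square: "s \<in> S \<Longrightarrow> s \<otimes> s = \<one>"
    and dual_vector: "\<exists>u. \<forall>s\<in>S. u \<bullet> e s = f s"
    and gram: "\<lbrakk>s \<in> S; t \<in> S\<rbrakk> \<Longrightarrow> e s \<bullet> e t = - cos (pi / real (ord (s \<otimes> t)))"
    and orthogonal_g: "w \<in> carrier W \<Longrightarrow> orthogonal_transformation (g w)"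
    and g_mult: "\<lbrakk>x \<in> carrier W; y \<in> carrier W\<rbrakk> \<Longrightarrow> g (x \<otimes> y) = g x \<circ> g y"
    and inj_g: "inj_on g (carrier W)"
    and g_S: "s \<in> S \<Longrightarrow> g s = reflection (e s)"
begin

abbreviation len :: "'a \<Rightarrow> nat"
  where "len \<equiv> word_length W S"

lemma S_carrier: "s \<in> S \<Longrightarrow> s \<in> carrier W"
  using S_subset by blast

lemma inv_S: "s \<in> S \<Longrightarrow> inv s = s"
  by (simp add: S_carrier S_square inv_equality)

lemma e_unit: "s \<in> S \<Longrightarrow> e s \<bullet> e s = 1"
  using gram[of s s] by (simp add: S_square)

lemma linear_g: "w \<in> carrier W \<Longrightarrow> linear (g w)"
  by (simp add: orthogonal_g orthogonal_transformation_linear)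

lemma inner_g: "w \<in> carrier W \<Longrightarrow> g w x \<bullet> g w y = x \<bullet> y"
  using orthogonal_g by (simp add: orthogonal_transformation_def)

lemma g_one: "g \<one> = (\<lambda>x. x)"
proof
  fix x
  have "g \<one> (g \<one> x) = g \<one> x"
    using g_mult[of \<one> \<one>] by (simp add: fun_eq_iff)
  moreover have "inj (g \<one>)"
    by (simp add: orthogonal_g orthogonal_transformation_inj)
  ultimately show "g \<one> x = x"
    by (simp add: inj_eq)
qed

lemma g_inv [simp]:
  assumes "w \<in> carrier W"
  shows "g (inv w) (g w x) = x" and "g w (g (inv w) x) = x"
  using assms g_mult[of "inv w" w] g_mult[of w "inv w"] g_one by (simp_all add: fun_eq_iff)

section \<open>Length with respect to the simple reflections\<close>

lemma S_word:
  assumes "w \<in> carrier W"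
  obtains xs where "xs \<in> lists S" "word_prod W xs = w" "length xs = len w"
proof -
  obtain xs where "xs \<in> lists S" "word_prod W xs = w"
    using generate_word[of S w] S_subset inv_S assms generate_S by auto
  then show ?thesis
    by (rule word_length_attained) (rule that)
qed

lemma lists_S_subset: "xs \<in> lists S \<Longrightarrow> set xs \<subseteq> carrier W"
  using S_subset by auto

lemma len_mult_le:
  assumes "x \<in> carrier W" "y \<in> carrier W"
  shows "len (x \<otimes> y) \<le> len x + len y"
proof -
  obtain xs ys where xs: "xs \<in> lists S" "word_prod W xs = x" "length xs = len x"
    and ys: "ys \<in> lists S" "word_prod W ys = y" "length ys = len y"
    using S_word assms by metis
  then have "word_prod W (xs @ ys) = x \<otimes> y"
    by (simp add: word_prod_append lists_S_subset)
  then show ?thesis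
    using word_length_le[of "xs @ ys" S W] xs ys by simp
qed

lemma len_one: "len \<one> = 0"
  using word_length_le[of "[]" S W] by simp

lemma len_S: "s \<in> S \<Longrightarrow> len s \<le> 1"
  using word_length_le[of "[s]" S W] by (simp add: S_carrier)

lemma len_inv_le:
  assumes "w \<in> carrier W"
  shows "len (inv w) \<le> len w"
proof -
  obtain xs where xs: "xs \<in> lists S" "word_prod W xs = w" "length xs = len w"
    using S_word assms by metis
  from xs(1) have "word_prod W (rev xs) = inv (word_prod W xs)"
  proof (induction xs)
    case (Cons x xs)
    then have "word_prod W (rev xs @ [x]) = inv (word_prod W xs) \<otimes> x"
      by (subst word_prod_append) (auto simp: lists_S_subset S_carrier)
    then show ?case
      using Cons by (simp add: inv_mult_group S_carrier inv_S word_prod_closed lists_S_subset)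
  qed simp
  moreover have "rev xs \<in> lists S"
    using xs(1) by auto
  ultimately show ?thesis
    using word_length_le[of "rev xs" S W] xs(2,3) by simp
qed

text \<open>Letters are added on the left, so the products are \<open>t\<close>,
  \<open>s \<otimes> t\<close>, \<open>t \<otimes> (s \<otimes> t)\<close> and so on, always ending
  in \<open>t\<close>. They are what gets stripped from the right end of \<open>w\<close> in Tits'
  argument.\<close>

primrec alternating :: "'a \<Rightarrow> 'a \<Rightarrow> nat \<Rightarrow> 'a"
  where "alternating s t 0 = \<one>"
  | "alternating s t (Suc k) = (if even k then t else s) \<otimes> alternating s t k"

section \<open>Dihedral subgroups generated by two simple reflections\<close>

context
  fixes s t assumes st: "s \<in> S" "t \<in> S"
begin

lemma alternating_closed: "alternating s t k \<in> carrier W"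
  using st by (induction k) (auto simp: S_carrier)

lemma len_alternating: "len (alternating s t k) \<le> k"
proof (induction k)
  case (Suc k)
  have "len (r \<otimes> alternating s t k) \<le> Suc k" if "r \<in> S" for r
    using len_mult_le[OF S_carrier[OF that] alternating_closed, of k] len_S[OF that] Suc by simp
  then show ?case using st by simp
qed (simp add: len_one)

lemma alternating_even: "alternating s t (2 * j) = (s \<otimes> t) [^] j"
proof (induction j)
  case (Suc j)
  have "alternating s t (2 * Suc j) = s \<otimes> (t \<otimes> (s \<otimes> t) [^] j)"
    by (simp add: Suc)
  also have "\<dots> = (s \<otimes> t) \<otimes> (s \<otimes> t) [^] j"
    by (simp add: m_assoc st S_carrier)
  also have "\<dots> = (s \<otimes> t) [^] Suc j"
    by (rule nat_pow_Suc2[symmetric]) (simp add: st S_carrier)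
  finally show ?case .
qed simp

lemma alternating_odd: "alternating s t (Suc (2 * j)) = t \<otimes> (s \<otimes> t) [^] j"
  by (simp add: alternating_even)

lemma pow_shift: "t \<otimes> (s \<otimes> t) [^] (j::nat) = (t \<otimes> s) [^] j \<otimes> t"
proof (induction j)
  case (Suc j)
  have "t \<otimes> (s \<otimes> t) [^] Suc j = (t \<otimes> (s \<otimes> t) [^] j) \<otimes> (s \<otimes> t)"
    by (simp add: m_assoc st S_carrier)
  also have "\<dots> = (t \<otimes> s) [^] Suc j \<otimes> t"
    by (simp add: Suc m_assoc st S_carrier)
  finally show ?case .
qed (simp add: st S_carrier)

text \<open>By the braid relation the alternating word of \<open>m\<close> letters can also be
  written to end in \<open>s\<close>, so multiplying by \<open>s\<close> cancels a letter. The
  product is the inverse of \<open>alternating s t (m - 1)\<close> for even \<open>m\<close> and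
  that element itself for odd \<open>m\<close>.\<close>

lemma len_alternating_ord: "len (alternating s t (ord (s \<otimes> t)) \<otimes> s) < ord (s \<otimes> t)"
proof -
  define m where "m = ord (s \<otimes> t)"
  have carr: "s \<in> carrier W" "t \<in> carrier W" "s \<otimes> t \<in> carrier W"
    using st by (auto simp: S_carrier)
  \<comment> \<open>Finiteness of the group excludes the value \<open>0\<close> of
    \<open>ord\<close>, which stands for infinite order.\<close>
  have m: "m \<ge> 1" "(s \<otimes> t) [^] m = \<one>"
    using carr finite_carrier ord_ge_1[of "s \<otimes> t"] by (simp_all add: m_def)
  have "len (alternating s t m \<otimes> s) \<le> len (alternating s t (m - 1))"
  proof (cases "even m")
    case True
    then obtain j where "m = 2 * j" by blast
    then obtain i where i: "m = 2 * Suc i"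
      using m(1) by (cases j) auto
    have "(alternating s t m \<otimes> s) \<otimes> alternating s t (m - 1)
        = (s \<otimes> t) [^] Suc i \<otimes> ((s \<otimes> t) \<otimes> (s \<otimes> t) [^] i)"
      unfolding i alternating_even using alternating_odd[of i] carr
      by (simp add: m_assoc del: alternating.simps)
    also have "\<dots> = (s \<otimes> t) [^] Suc i \<otimes> (s \<otimes> t) [^] Suc i"
      using carr nat_pow_Suc2[of "s \<otimes> t" i] by simp
    also have "\<dots> = (s \<otimes> t) [^] m"
      unfolding i mult_2 by (rule nat_pow_mult[OF carr(3)])
    finally have "inv (alternating s t (m - 1)) = alternating s t m \<otimes> s"
      using m(2) carr alternating_closed by (intro inv_equality) auto
    then show ?thesis
      using len_inv_le[OF alternating_closed, of "m - 1"] by simp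
  next
    case False
    then obtain j where j: "m = Suc (2 * j)"
      by (metis oddE Suc_eq_plus1)
    have "alternating s t m \<otimes> s = (t \<otimes> s) [^] j \<otimes> t \<otimes> s"
      unfolding j alternating_odd pow_shift ..
    also have "\<dots> = (inv (s \<otimes> t)) [^] Suc j"
      using carr st by (simp add: inv_mult_group inv_S m_assoc)
    also have "\<dots> = inv ((s \<otimes> t) [^] Suc j)"
      using carr by (metis nat_pow_inv)
    also have "\<dots> = (s \<otimes> t) [^] j"
    proof (rule inv_equality)
      show "(s \<otimes> t) [^] j \<otimes> (s \<otimes> t) [^] Suc j = \<one>"
        unfolding nat_pow_mult[OF carr(3)] using m(2) by (simp add: j mult_2 del: nat_pow_Suc)
    qed (use carr in auto)
    finally show ?thesis
      by (simp add: j alternating_even)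
  qed
  then show ?thesis
    using len_alternating[of "m - 1"] m(1) unfolding m_def by linarith
qed

text \<open>Rotation in the plane of \<open>e s\<close> and \<open>e t\<close>, which enclose the
  angle \<open>pi - \<theta>\<close>. Scaling by \<open>sin \<theta>\<close> keeps the formula free
  of division.\<close>

lemma g_alternating:
  defines "\<theta> \<equiv> pi / real (ord (s \<otimes> t))"
  shows "sin \<theta> *\<^sub>R g (alternating s t k) (e s) =
    sin (real (Suc k) * \<theta>) *\<^sub>R e (if even k then s else t) + sin (real k * \<theta>) *\<^sub>R e (if even k then t else s)"
proof (induction k)
  case 0
  show ?case by (simp add: g_one)
next
  case (Suc k)
  \<comment> \<open>\<open>q\<close> is the letter added next. Its reflection keeps the coefficient
    of \<open>e p\<close> and changes that of \<open>e q\<close> according to the recurrence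
    \<open>trig\<close>.\<close>
  define p q where "p = (if even k then s else t)" and "q = (if even k then t else s)"
  have pq: "p \<in> S" "q \<in> S" "e p \<bullet> e q = - cos \<theta>"
    using st gram[OF st] by (auto simp: p_def q_def \<theta>_def inner_commute)
  have refl: "reflection (e q) (e p) = e p + (2 * cos \<theta>) *\<^sub>R e q" "reflection (e q) (e q) = - e q"
    using pq by (simp_all add: reflection_self) (simp add: reflection_def e_unit)
  have lin: "linear (reflection (e q))"
    using orthogonal_transformation_reflection orthogonal_transformation_linear by blast
  have trig: "sin (real (Suc (Suc k)) * \<theta>) = 2 * cos \<theta> * sin (real (Suc k) * \<theta>) - sin (real k * \<theta>)"
  proof -
    have "real (Suc (Suc k)) * \<theta> = real (Suc k) * \<theta> + \<theta>" "real k * \<theta> = real (Suc k) * \<theta> - \<theta>"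
      by (simp_all add: algebra_simps)
    then show ?thesis
      by (simp only: sin_add sin_diff) (simp add: algebra_simps)
  qed
  have "sin \<theta> *\<^sub>R g (alternating s t (Suc k)) (e s)
      = reflection (e q) (sin \<theta> *\<^sub>R g (alternating s t k) (e s))"
    using pq st unfolding linear_scale[OF lin]
    by (simp add: q_def[symmetric] g_mult alternating_closed S_carrier g_S)
  also have "\<dots> = reflection (e q) (sin (real (Suc k) * \<theta>) *\<^sub>R e p + sin (real k * \<theta>) *\<^sub>R e q)"
    unfolding Suc by (simp add: p_def q_def)
  also have "\<dots> = sin (real (Suc k) * \<theta>) *\<^sub>R (e p + (2 * cos \<theta>) *\<^sub>R e q) - sin (real k * \<theta>) *\<^sub>R e q"
    by (simp add: linear_add[OF lin] linear_scale[OF lin] refl)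
  also have "\<dots> = sin (real (Suc (Suc k)) * \<theta>) *\<^sub>R e q + sin (real (Suc k) * \<theta>) *\<^sub>R e p"
    unfolding trig by (simp add: algebra_simps)
  finally show ?case
    by (simp add: p_def q_def)
qed

end

section \<open>The fundamental chamber and its stabilizers\<close>

definition chamber :: "'v set"
  where "chamber = {u. \<forall>s\<in>S. 0 \<le> u \<bullet> e s}"

text \<open>
  Tits' argument: strip from \<open>w\<close> the longest alternating word in \<open>s\<close> and \<open>t\<close>, ending in \<open>t\<close>, that
  shortens \<open>w\<close>. Its length \<open>k\<close> is less than the order \<open>m\<close> of \<open>st\<close>, so the coefficients
  \<open>sin ((k + 1) \<pi> / m)\<close> and \<open>sin (k \<pi> / m)\<close> are nonnegative.
\<close>

lemma root_nonneg_on_chamber: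
  assumes "w \<in> carrier W" "s \<in> S" "len w \<le> len (w \<otimes> s)" "u \<in> chamber"
  shows "0 \<le> u \<bullet> g w (e s)"
  using assms(1-3)
proof (induction "len w" arbitrary: w s rule: less_induct)
  case less
  show ?case
  proof (cases "len w = 0")
    case True
    then have "w = \<one>"
      using S_word[OF less.prems(1)] by fastforce
    then show ?thesis
      using assms(4) less.prems by (simp add: g_one chamber_def)
  next
    case False
    obtain xs where xs: "xs \<in> lists S" "word_prod W xs = w" "length xs = len w"
      using S_word less.prems(1) by blast
    then have "xs \<noteq> []"
      using False by auto
    \<comment> \<open>The last letter \<open>t\<close> of a reduced word shortens \<open>w\<close>,
      whereas \<open>s\<close> does not; this contrast drives the argument in the dihedral group of
      \<open>s\<close> and \<open>t\<close>.\<close>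
    then obtain ys t where ys: "xs = ys @ [t]"
      by (metis rev_exhaust)
    define v where "v = word_prod W ys"
    have t: "t \<in> S" and v: "v \<in> carrier W" and w: "w = v \<otimes> t"
      using xs ys unfolding v_def
      by (auto simp: word_prod_append lists_S_subset S_carrier word_prod_closed subset_iff)
    have len_v: "len v + 1 \<le> len w"
      using word_length_le[of ys S W] xs ys by (auto simp: v_def)
    note s = less.prems(2)
    note st = s t
    have carr: "s \<in> carrier W" "t \<in> carrier W" "s \<otimes> t \<in> carrier W"
      using st by (auto simp: S_carrier)
    have "v = w \<otimes> t"
      using v carr t by (simp add: w m_assoc S_square)
    define m where "m = ord (s \<otimes> t)"
    \<comment> \<open>\<open>r k\<close> is what remains of \<open>w\<close> after stripping
      \<open>k\<close> alternating letters; \<open>P k\<close> below says that each of these letters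
      has reduced the length.\<close>
    define r where "r k = w \<otimes> inv (alternating s t k)" for k
    have alt: "alternating s t k \<in> carrier W" for k
      using alternating_closed st by blast
    have r_carr: "r k \<in> carrier W" and w_r: "w = r k \<otimes> alternating s t k" for k
      using less.prems(1) alt[of k] by (simp_all add: r_def m_assoc)
    have len_r: "len w \<le> len (r k) + k" for k
      using len_mult_le[OF r_carr alt, of k k] len_alternating[OF st, of k] w_r[of k] by simp
    have r_Suc: "r (Suc k) = r k \<otimes> (if even k then t else s)" for k
      using carr alt[of k] less.prems(1) st
      by (simp add: r_def inv_mult_group inv_S m_assoc)
    define P where "P k \<longleftrightarrow> len (r k) + k = len w" for k
    have P1: "P 1"
      using len_r[of 1] len_v \<open>v = w \<otimes> t\<close> carr less.prems(1) t by (simp add: P_def r_def inv_S)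
    have P_bound: "k \<le> len w" if "P k" for k
      using that by (simp add: P_def)
    \<comment> \<open>The maximum exists: \<open>P 1\<close> holds because stripping
      \<open>t\<close> leaves the shorter \<open>v\<close>, and \<open>P k\<close> bounds
      \<open>k\<close> by \<open>len w\<close>.\<close>
    define k where "k = (GREATEST k. P k)"
    have Pk: "P k" and k_max: "\<And>j. P j \<Longrightarrow> j \<le> k"
      unfolding k_def using GreatestI_nat[of P 1 "len w"] Greatest_le_nat[of P _ "len w"] P1 P_bound
      by auto
    have "1 \<le> k"
      by (rule k_max[OF P1])
    \<comment> \<open>Putting a letter back lengthens by at most one, so \<open>P\<close> passes to
      smaller indices. It is needed at \<open>m\<close> and at \<open>k - 1\<close>.\<close>
    have P_down: "P j" if "j \<le> k" for j
      using that
    proof (induction rule: inc_induct)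
      case base
      show ?case by (rule Pk)
    next
      case (step i)
      have "r i = r (Suc i) \<otimes> (if even i then t else s)"
        unfolding r_Suc using st r_carr[of i] by (simp add: m_assoc S_carrier S_square)
      then have "len (r i) \<le> len (r (Suc i)) + 1"
        using len_mult_le[OF r_carr, of "if even i then t else s" "Suc i"] len_S st S_carrier
        by (smt (verit) add_le_cancel_left order_trans)
      then show ?case
        using step len_r[of i] by (simp add: P_def)
    qed
    \<comment> \<open>Otherwise a reduced word of \<open>w\<close> could end in \<open>m\<close>
      alternating letters, and the braid relation would let \<open>s\<close> shorten
      \<open>w\<close>.\<close>
    have "k < m"
    proof (rule ccontr)
      assume "\<not> k < m"
      then have "P m"
        by (simp add: P_down)
      have "w \<otimes> s = r m \<otimes> (alternating s t m \<otimes> s)"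
        using w_r[of m] r_carr[of m] alt[of m] carr by (metis m_assoc)
      then have "len (w \<otimes> s) \<le> len (r m) + len (alternating s t m \<otimes> s)"
        using len_mult_le[OF r_carr, of "alternating s t m \<otimes> s" m] alt carr by simp
      also have "\<dots> < len w"
        using \<open>P m\<close> len_alternating_ord[OF st] by (simp add: P_def m_def)
      finally show False
        using less.prems(3) by simp
    qed
    obtain k' where k': "k = Suc k'"
      using \<open>1 \<le> k\<close> by (cases k) auto
    \<comment> \<open>The letter that would continue the stripping does not shorten
      \<open>r k\<close>, by maximality of \<open>k\<close>; the other one leads back to
      \<open>r (k - 1)\<close>, which is longer. So the induction hypothesis covers both
      \<open>e s\<close> and \<open>e t\<close>.\<close>
    have "len (r k) \<le> len (r k \<otimes> q)" if "q \<in> {s, t}" for q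
    proof (cases "q = (if even k then t else s)")
      case True
      have "len (r k) \<le> len (r (Suc k))"
        using len_r[of "Suc k"] k_max[of "Suc k"] Pk unfolding P_def by linarith
      then show ?thesis
        by (simp add: r_Suc True)
    next
      case False
      then have "q = (if even k' then t else s)"
        using that by (auto simp: k')
      then have "r k \<otimes> q = r k'"
        unfolding k' r_Suc using r_carr[of k'] carr st by (simp add: m_assoc S_square)
      then show ?thesis
        using P_down[of k'] Pk by (simp add: P_def k')
    qed
    moreover have "len (r k) < len w"
      using Pk \<open>1 \<le> k\<close> by (simp add: P_def)
    ultimately have pos: "0 \<le> u \<bullet> g (r k) (e s)" "0 \<le> u \<bullet> g (r k) (e t)"
      using less.hyps[OF _ r_carr] st by auto
    define \<theta> where "\<theta> = pi / real m"
    \<comment> \<open>This yields \<open>m \<ge> 2\<close>, hence a positive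
      \<open>sin \<theta>\<close> that can be cancelled at the end.\<close>
    have "s \<noteq> t"
    proof
      assume "s = t"
      then have "len (w \<otimes> s) = len v"
        by (simp add: \<open>v = w \<otimes> t\<close>)
      then show False
        using len_v less.prems(3) by simp
    qed
    then have "s \<otimes> t \<noteq> \<one>"
      using carr inv_equality[of s t] inv_S[OF t] by metis
    moreover have "m \<ge> 1"
      using carr finite_carrier ord_ge_1 by (simp add: m_def del: One_nat_def)
    ultimately have "m \<ge> 2"
      using ord_eq_1[OF carr(3)] unfolding m_def by linarith
    have sin_ge: "0 \<le> sin (real j * \<theta>)" if "j \<le> m" for j
      using that \<open>m \<ge> 2\<close> by (intro sin_ge_zero) (auto simp: \<theta>_def field_simps)
    have sin_pos: "0 < sin \<theta>"
      using \<open>m \<ge> 2\<close> by (intro sin_gt_zero) (auto simp: \<theta>_def field_simps)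
    have lin: "linear (g (r k))"
      by (simp add: linear_g r_carr)
    have "sin \<theta> * (u \<bullet> g w (e s)) = u \<bullet> g (r k) (sin \<theta> *\<^sub>R g (alternating s t k) (e s))"
      using g_mult[OF r_carr alt, of k k] w_r[of k] by (simp add: linear_scale[OF lin])
    also have "\<dots> = sin (real (Suc k) * \<theta>) * (u \<bullet> g (r k) (e (if even k then s else t)))
        + sin (real k * \<theta>) * (u \<bullet> g (r k) (e (if even k then t else s)))"
      unfolding \<theta>_def m_def g_alternating[OF st]
      by (simp only: linear_add[OF lin] linear_scale[OF lin] inner_add_right inner_scaleR_right)
    also have "0 \<le> \<dots>"
      using pos sin_ge[of k] sin_ge[of "Suc k"] \<open>k < m\<close> by simp
    finally show ?thesis
      using sin_pos by (simp add: zero_le_mult_iff)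
  qed
qed

text \<open>Let \<open>s\<close> be the last letter of a reduced word of
  \<open>w = v \<otimes> s\<close>. The root \<open>g v (e s)\<close> is nonnegative on the chamber,
  in particular at \<open>g w u\<close>, where its value is \<open>- (u \<bullet> e s)\<close>. As
  \<open>u\<close> is in the chamber too, \<open>s\<close> fixes \<open>u\<close>, and the induction
  continues with \<open>v\<close>.\<close>

lemma chamber_fundamental:
  assumes "w \<in> carrier W" "u \<in> chamber" "g w u \<in> chamber"
  shows "w \<in> generate W {s \<in> S. u \<bullet> e s = 0}"
  using assms(1,3)
proof (induction "len w" arbitrary: w rule: less_induct)
  case less
  obtain xs where xs: "xs \<in> lists S" "word_prod W xs = w" "length xs = len w"
    using S_word less.prems(1) by blast
  show ?case
  proof (cases xs rule: rev_cases)
    case Nil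
    then show ?thesis
      using xs generate.one by force
  next
    case (snoc ys s)
    define v where "v = word_prod W ys"
    have s: "s \<in> S" and v: "v \<in> carrier W" and w: "w = v \<otimes> s"
      using xs snoc unfolding v_def
      by (auto simp: word_prod_append lists_S_subset S_carrier word_prod_closed subset_iff)
    have len_v: "len v < len w"
      using word_length_le[of ys S W] xs snoc by (auto simp: v_def)
    have gw: "g w x = g v (reflection (e s) x)" for x
      by (simp add: w g_mult v S_carrier s g_S)
    have "0 \<le> g w u \<bullet> g v (e s)"
      using root_nonneg_on_chamber[OF v s _ less.prems(2)] len_v by (simp add: w)
    also have "g w u \<bullet> g v (e s) = - (g w u \<bullet> g w (e s))"
      by (simp add: gw reflection_self linear_neg[OF linear_g[OF v]])
    also have "\<dots> = - (u \<bullet> e s)"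
      by (simp add: inner_g less.prems)
    finally have us: "u \<bullet> e s = 0"
      using assms(2) s by (auto simp: chamber_def)
    then have "g v u = g w u"
      by (simp add: gw reflection_def)
    then have "v \<in> generate W {s \<in> S. u \<bullet> e s = 0}"
      using less.hyps[OF len_v v] less.prems by simp
    then show ?thesis
      unfolding w by (rule generate.eng) (simp add: generate.incl s us)
  qed
qed

end

section \<open>Roots\<close>

text \<open>Each \<open>\<alpha>\<close> outside the moved space cuts out a proper subspace of the
  fixed space, and finitely many of these do not cover it. The induction adds to \<open>u\<close> a
  multiple of a fixed vector \<open>v\<close> that is not orthogonal to
  \<open>\<alpha>\<close>.\<close>

lemma generic_fixed_vector:
  fixes f :: "'v::euclidean_space \<Rightarrow> 'v"
  assumes f: "orthogonal_transformation f" and "finite F"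
  shows "\<exists>u. f u = u \<and> (\<forall>\<alpha>\<in>F. u \<bullet> \<alpha> = 0 \<longrightarrow> \<alpha> \<in> moved_space f)"
  using \<open>finite F\<close>
proof (induction F)
  case empty
  have "f 0 = 0"
    by (rule linear_0[OF orthogonal_transformation_linear[OF f]])
  then show ?case by auto
next
  case (insert \<alpha> F)
  then obtain u where u: "f u = u" "\<And>\<beta>. \<lbrakk>\<beta> \<in> F; u \<bullet> \<beta> = 0\<rbrakk> \<Longrightarrow> \<beta> \<in> moved_space f"
    by blast
  show ?case
  proof (cases "u \<bullet> \<alpha> = 0 \<and> \<alpha> \<notin> moved_space f")
    case False
    then show ?thesis using u by blast
  next
    case True
    then obtain v where v: "f v = v" "v \<bullet> \<alpha> \<noteq> 0"
      using moved_space_iff[OF f] by blast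
    \<comment> \<open>The excluded values of \<open>c\<close> are \<open>0\<close>, where
      \<open>w\<close> would be \<open>u\<close>, and those at which \<open>w\<close> becomes
      orthogonal to some \<open>\<beta>\<close> with \<open>v \<bullet> \<beta>\<close> nonzero. If
      \<open>v \<bullet> \<beta> = 0\<close>, the quotient is \<open>0\<close> by convention and
      excludes nothing more.\<close>
    have "finite (insert 0 ((\<lambda>\<beta>. - (u \<bullet> \<beta>) / (v \<bullet> \<beta>)) ` F))"
      using insert.hyps by simp
    then obtain c where c: "c \<notin> insert 0 ((\<lambda>\<beta>. - (u \<bullet> \<beta>) / (v \<bullet> \<beta>)) ` F)"
      using ex_new_if_finite[OF infinite_UNIV_char_0] by blast
    define w where "w = u + c *\<^sub>R v"
    have "f w = w"
      using orthogonal_transformation_linear[OF f] u(1) v(1)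
      by (simp add: w_def linear_add linear_scale)
    moreover have "w \<bullet> \<alpha> \<noteq> 0"
      using True c v by (simp add: w_def inner_add_left)
    moreover have "\<beta> \<in> moved_space f" if "\<beta> \<in> F" "w \<bullet> \<beta> = 0" for \<beta>
    proof -
      have *: "c * (v \<bullet> \<beta>) = - (u \<bullet> \<beta>)"
        using that(2) by (simp add: w_def inner_add_left)
      have "v \<bullet> \<beta> = 0"
      proof (rule ccontr)
        assume "v \<bullet> \<beta> \<noteq> 0"
        then have "c = - (u \<bullet> \<beta>) / (v \<bullet> \<beta>)"
          using * by (simp add: field_simps)
        then show False using c that(1) by blast
      qed
      then show ?thesis
        using * u(2)[OF that(1)] by simp
    qed
    ultimately show ?thesis by blast
  qed
qed

text \<open>Roots enter through the reflections they define, so their lengths are free, and a simple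
  root \<open>e s\<close> is proportional to a root but may lie outside
  \<open>\<Phi>\<close>.\<close>

locale finite_coxeter_roots = finite_coxeter_action W S e g
  for W (structure) and S and e :: "'a \<Rightarrow> 'v::euclidean_space" and g +
  fixes \<Phi> :: "'v set"
  assumes finite_roots: "finite \<Phi>"
    and zero_notin_roots: "0 \<notin> \<Phi>"
    and root_reflection: "\<alpha> \<in> \<Phi> \<Longrightarrow> \<exists>t\<in>reflections W S. g t = reflection \<alpha>"
    and reflection_root: "t \<in> reflections W S \<Longrightarrow> \<exists>\<alpha>\<in>\<Phi>. g t = reflection \<alpha>"
begin

abbreviation moved :: "'a \<Rightarrow> 'v set"
  where "moved w \<equiv> moved_space (g w)"

lemma root_nonzero: "\<alpha> \<in> \<Phi> \<Longrightarrow> \<alpha> \<noteq> 0"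
  using zero_notin_roots by blast

lemma reflections_closed: "t \<in> reflections W S \<Longrightarrow> t \<in> carrier W"
  by (auto simp: reflections_def S_carrier)

lemma reflections_conj:
  assumes "x \<in> carrier W" "s \<in> S"
  shows "x \<otimes> s \<otimes> inv x \<in> reflections W S"
    and "g (x \<otimes> s \<otimes> inv x) = reflection (g x (e s))"
proof -
  show "x \<otimes> s \<otimes> inv x \<in> reflections W S"
    using assms by (auto simp: reflections_def)
  show "g (x \<otimes> s \<otimes> inv x) = reflection (g x (e s))"
    using assms by (simp add: fun_eq_iff g_mult S_carrier g_S reflection_conj orthogonal_g)
qed

lemma subspace_moved: "w \<in> carrier W \<Longrightarrow> subspace (moved w)"
  by (simp add: subspace_moved_space linear_g)

text \<open>Let \<open>d\<close> have inner product \<open>1\<close> with all simple roots and let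
  \<open>x\<close> maximize \<open>g x u \<bullet> d\<close> over the finite group. If
  \<open>g x u \<bullet> e s\<close> were negative, \<open>s \<otimes> x\<close> would give a larger
  value.\<close>

lemma ex_chamber: "\<exists>x\<in>carrier W. g x u \<in> chamber"
proof -
  obtain d where d: "\<And>s. s \<in> S \<Longrightarrow> d \<bullet> e s = 1"
    using dual_vector[of "\<lambda>_. 1"] by blast
  define M where "M = Max ((\<lambda>x. g x u \<bullet> d) ` carrier W)"
  have "M \<in> (\<lambda>x. g x u \<bullet> d) ` carrier W"
    unfolding M_def using finite_carrier by (intro Max_in) auto
  then obtain x where x: "x \<in> carrier W" "g x u \<bullet> d = M"
    by blast
  have "0 \<le> g x u \<bullet> e s" if s: "s \<in> S" for s
  proof -
    have "g (s \<otimes> x) u \<bullet> d \<le> M"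
      unfolding M_def using finite_carrier x s S_carrier by (intro Max_ge) auto
    moreover have "g (s \<otimes> x) u = g x u - (2 * (g x u \<bullet> e s)) *\<^sub>R e s"
      using x s by (simp add: g_mult S_carrier g_S reflection_def e_unit)
    ultimately show ?thesis
      using x(2) d[OF s] by (simp add: inner_diff_left inner_commute[of "e s" d])
  qed
  then show ?thesis
    using x by (auto simp: chamber_def)
qed

text \<open>Move a generic fixed point \<open>u\<close> of \<open>w\<close> into the chamber. The
  conjugate \<open>v\<close> of \<open>w\<close> fixes the image and is not \<open>\<one>\<close>,
  so some simple \<open>s\<close> fixes it as well. Conjugated back, \<open>s\<close> is a
  reflection fixing \<open>u\<close>; its root is orthogonal to \<open>u\<close>, hence in
  \<open>moved w\<close> by genericity.\<close>

lemma root_in_moved: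
  assumes w: "w \<in> carrier W" "w \<noteq> \<one>"
  shows "\<exists>\<alpha>\<in>\<Phi>. \<alpha> \<in> moved w"
proof -
  obtain u where u: "g w u = u" "\<And>\<alpha>. \<lbrakk>\<alpha> \<in> \<Phi>; u \<bullet> \<alpha> = 0\<rbrakk> \<Longrightarrow> \<alpha> \<in> moved w"
    using generic_fixed_vector[OF orthogonal_g[OF w(1)] finite_roots] by blast
  obtain x where x: "x \<in> carrier W" "g x u \<in> chamber"
    using ex_chamber by blast
  define v where "v = x \<otimes> w \<otimes> inv x"
  have v: "v \<in> carrier W"
    using w x by (simp add: v_def)
  have "v \<noteq> \<one>"
  proof
    assume "v = \<one>"
    then have "x \<otimes> w = x"
      using w x by (metis v_def inv_closed inv_equality inv_inv m_closed)
    then show False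
      using w x by simp
  qed
  have "g v (g x u) = g x u"
    using w x u(1) by (simp add: v_def g_mult)
  then have "v \<in> generate W {s \<in> S. g x u \<bullet> e s = 0}"
    using chamber_fundamental[OF v x(2)] x(2) by simp
  moreover have "v \<notin> generate W {}"
    using \<open>v \<noteq> \<one>\<close> by (simp add: generate_empty)
  ultimately have "{s \<in> S. g x u \<bullet> e s = 0} \<noteq> {}"
    by metis
  then obtain s where s: "s \<in> S" "g x u \<bullet> e s = 0"
    by blast
  have x': "inv x \<in> carrier W"
    using x by simp
  have "u \<bullet> g (inv x) (e s) = 0"
    using inner_g[OF x(1), of u "g (inv x) (e s)"] x s by simp
  then have fixed: "g (inv x \<otimes> s \<otimes> inv (inv x)) u = u"
    unfolding reflections_conj(2)[OF x' s(1)] by (simp add: reflection_def)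
  obtain \<alpha> where \<alpha>: "\<alpha> \<in> \<Phi>" "g (inv x \<otimes> s \<otimes> inv (inv x)) = reflection \<alpha>"
    using reflection_root[OF reflections_conj(1)[OF x' s(1)]] by blast
  then have "u \<bullet> \<alpha> = 0"
    using fixed reflection_eq_iff[OF root_nonzero[OF \<alpha>(1)]] by simp
  then show ?thesis
    using u(2) \<alpha>(1) by blast
qed

section \<open>Reflection length as a dimension: Carter's lemma\<close>

lemma reflection_step:
  assumes w: "w \<in> carrier W" "w \<noteq> \<one>"
  obtains t \<alpha> where "t \<in> reflections W S" "\<alpha> \<in> \<Phi>" "\<alpha> \<in> moved w" "g t = reflection \<alpha>"
    "t \<otimes> t = \<one>" "Suc (dim (moved (w \<otimes> t))) = dim (moved w)"
    "moved w = span (insert \<alpha> (moved (w \<otimes> t)))"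
proof -
  obtain \<alpha> where \<alpha>: "\<alpha> \<in> \<Phi>" "\<alpha> \<in> moved w"
    using root_in_moved[OF w] by blast
  obtain t where t: "t \<in> reflections W S" "g t = reflection \<alpha>"
    using root_reflection[OF \<alpha>(1)] by blast
  have tc: "t \<in> carrier W"
    using t by (simp add: reflections_closed)
  have "g (t \<otimes> t) = g \<one>"
    using tc t by (simp add: fun_eq_iff g_mult g_one)
  then have "t \<otimes> t = \<one>"
    using inj_g tc by (auto dest: inj_onD)
  moreover have "g (w \<otimes> t) = g w \<circ> reflection \<alpha>"
    using w tc t by (simp add: g_mult)
  ultimately show ?thesis
    using that[OF t(1) \<alpha> t(2)]
      moved_space_comp_reflection_in[OF orthogonal_g[OF w(1)] \<alpha>(2) root_nonzero[OF \<alpha>(1)]]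
    by simp
qed

lemma reflection_word:
  assumes "w \<in> carrier W"
  shows "\<exists>xs\<in>lists (reflections W S). word_prod W xs = w \<and> length xs = dim (moved w)"
  using assms
proof (induction "dim (moved w)" arbitrary: w rule: less_induct)
  case less
  show ?case
  proof (cases "w = \<one>")
    case True
    then show ?thesis
      by (intro bexI[of _ "[]"]) (auto simp: g_one moved_space_id)
  next
    case False
    obtain t \<alpha> where t: "t \<in> reflections W S" "t \<otimes> t = \<one>"
        "Suc (dim (moved (w \<otimes> t))) = dim (moved w)"
      by (rule reflection_step[OF less.prems False])
    have tc: "t \<in> carrier W"
      using t by (simp add: reflections_closed)
    obtain xs where xs: "xs \<in> lists (reflections W S)" "word_prod W xs = w \<otimes> t"
        "length xs = dim (moved (w \<otimes> t))"
      using less.hyps[of "w \<otimes> t"] t tc less.prems by auto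
    then have "word_prod W (xs @ [t]) = w \<otimes> t \<otimes> t"
      using tc reflections_closed by (subst word_prod_append) auto
    then have "word_prod W (xs @ [t]) = w"
      using less.prems tc t by (simp add: m_assoc)
    then show ?thesis
      using xs t by (intro bexI[of _ "xs @ [t]"]) auto
  qed
qed

lemma dim_moved_word_le:
  assumes "xs \<in> lists (reflections W S)"
  shows "dim (moved (word_prod W xs)) \<le> length xs"
  using assms
proof (induction xs)
  case Nil
  then show ?case by (simp add: g_one moved_space_id)
next
  case (Cons t xs)
  then obtain \<alpha> where \<alpha>: "\<alpha> \<in> \<Phi>" "g t = reflection \<alpha>"
    using reflection_root by (auto simp: Cons_in_lists_iff)
  have carr: "t \<in> carrier W" "word_prod W xs \<in> carrier W"
    using Cons by (auto simp: reflections_closed intro: word_prod_closed)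
  have "dim (moved t) = 1"
    using root_nonzero[OF \<alpha>(1)] by (simp add: \<alpha>(2) moved_space_reflection dim_insert)
  then have "dim (moved_space (g t \<circ> g (word_prod W xs))) \<le> Suc (length xs)"
    using dim_moved_space_comp_le[OF orthogonal_g orthogonal_g, OF carr] Cons by simp
  moreover have "length (t # xs) = Suc (length xs)"
    by simp
  ultimately show ?case
    by (simp only: word_prod_Cons g_mult[OF carr])
qed

text \<open>Splitting off reflections in roots of the moved space lowers the dimension by one each
  time and ends at \<open>\<one>\<close>; on the other hand, each letter of a word contributes at
  most one dimension.\<close>

lemma reflection_length_eq_dim_moved:
  assumes "w \<in> carrier W"
  shows "reflection_length W S w = dim (moved w)"
proof -
  obtain xs where xs: "xs \<in> lists (reflections W S)" "word_prod W xs = w" "length xs = dim (moved w)"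
    using reflection_word[OF assms] by blast
  obtain ys where ys: "ys \<in> lists (reflections W S)" "word_prod W ys = w"
      "length ys = reflection_length W S w"
    using word_length_attained[OF xs(1,2)] unfolding reflection_length_eq by metis
  show ?thesis
    using dim_moved_word_le[OF ys(1)] word_length_le[OF xs(1), of W] xs ys
    by (simp add: reflection_length_eq)
qed

section \<open>Moved spaces are exactly the subspaces spanned by roots\<close>

lemma moved_eq_span_roots:
  assumes "w \<in> carrier W"
  shows "moved w = span (\<Phi> \<inter> moved w)"
  using assms
proof (induction "dim (moved w)" arbitrary: w rule: less_induct)
  case less
  \<comment> \<open>Split off a reflection: \<open>moved w\<close> is spanned by a root and the
    smaller \<open>moved (w \<otimes> t)\<close>, to which induction applies.\<close>
  have "moved w \<subseteq> span (\<Phi> \<inter> moved w)"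
  proof (cases "w = \<one>")
    case True
    then show ?thesis by (simp add: g_one moved_space_id span_0)
  next
    case False
    obtain t \<alpha> where t: "t \<in> reflections W S" "\<alpha> \<in> \<Phi>" "\<alpha> \<in> moved w"
        "Suc (dim (moved (w \<otimes> t))) = dim (moved w)"
        "moved w = span (insert \<alpha> (moved (w \<otimes> t)))"
      by (rule reflection_step[OF less.prems False])
    have IH: "moved (w \<otimes> t) = span (\<Phi> \<inter> moved (w \<otimes> t))"
      by (rule less.hyps) (use less.prems t(1,4) reflections_closed in auto)
    have "moved (w \<otimes> t) \<subseteq> moved w"
      using span_superset[of "insert \<alpha> (moved (w \<otimes> t))"] unfolding t(5)[symmetric] by simp
    then have "moved (w \<otimes> t) \<subseteq> span (\<Phi> \<inter> moved w)"
      by (subst IH) (intro span_mono, blast)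
    moreover have "\<alpha> \<in> span (\<Phi> \<inter> moved w)"
      using t by (intro span_base) simp
    ultimately show ?thesis
      by (subst t(5)) (intro span_minimal, simp_all)
  qed
  moreover have "span (\<Phi> \<inter> moved w) \<subseteq> moved w"
    using subspace_moved[OF less.prems] by (intro span_minimal) auto
  ultimately show ?case by blast
qed

text \<open>Multiply the reflections in the roots of \<open>A\<close> one after the other, skipping
  each root in the span of the earlier ones, so that every factor enlarges the moved space.\<close>

lemma ex_moved_eq_span:
  assumes "A \<subseteq> \<Phi>"
  shows "\<exists>w\<in>carrier W. moved w = span A"
  using finite_subset[OF assms finite_roots] assms
proof (induction A)
  case empty
  then show ?case
    by (intro bexI[of _ \<one>]) (auto simp: g_one moved_space_id)
next
  case (insert \<alpha> A)
  then obtain w where w: "w \<in> carrier W" "moved w = span A"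
    by blast
  show ?case
  proof (cases "\<alpha> \<in> span A")
    case True
    then show ?thesis
      using w span_redundant by blast
  next
    case False
    obtain t where t: "t \<in> reflections W S" "g t = reflection \<alpha>"
      using root_reflection insert.prems by blast
    then have "moved (w \<otimes> t) = span (insert \<alpha> (span A))"
      using moved_space_comp_reflection_notin(1)[OF orthogonal_g[OF w(1)], of \<alpha>] False w
      by (simp add: g_mult reflections_closed)
    also have "\<dots> = span (insert \<alpha> A)"
      by (simp only: span_insert span_span)
    finally show ?thesis
      using w t reflections_closed by blast
  qed
qed

lemma moved_conj:
  assumes "x \<in> carrier W" "h \<in> carrier W"
  shows "moved (x \<otimes> h \<otimes> inv x) = g x ` moved h"
proof -
  have "g (x \<otimes> h \<otimes> inv x) y - y = g x (g h (g (inv x) y) - g (inv x) y)" for y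
    using assms by (simp add: g_mult linear_diff[OF linear_g])
  moreover have "range (g (inv x)) = UNIV"
    using assms by (simp add: orthogonal_g orthogonal_transformation_surj)
  then have "moved h = (\<lambda>y. g h y - y) ` range (g (inv x))"
    by (simp add: moved_space_def)
  ultimately show ?thesis
    by (simp add: moved_space_def image_image)
qed

lemma dim_moved_conj:
  assumes "x \<in> carrier W" "h \<in> carrier W"
  shows "dim (moved (x \<otimes> h \<otimes> inv x)) = dim (moved h)"
  unfolding moved_conj[OF assms]
  by (rule dim_image_eq)
    (use assms in \<open>simp_all add: linear_g inj_on_subset[OF orthogonal_transformation_inj] orthogonal_g\<close>)

section \<open>Parabolic subgroups\<close>

lemma mem_standard_parabolic_iff:
  assumes J: "J \<subseteq> S" and h: "h \<in> carrier W"
  shows "h \<in> generate W J \<longleftrightarrow> moved h \<subseteq> span (e ` J)"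
proof
  assume "h \<in> generate W J"
  then show "moved h \<subseteq> span (e ` J)"
  proof (induction rule: generate.induct)
    case one
    then show ?case by (simp add: g_one moved_space_id span_0)
  next
    case (incl s)
    then have "s \<in> S"
      using J by blast
    then have "moved s = span {e s}"
      using e_unit[of s] by (simp add: g_S) (rule moved_space_reflection, auto)
    then show ?case
      using incl by (auto intro!: span_mono)
  next
    case (inv s)
    then have "s \<in> S"
      using J by blast
    then have "moved (inv s) = span {e s}"
      using e_unit[of s] by (simp add: g_S inv_S) (rule moved_space_reflection, auto)
    then show ?case
      using inv by (auto intro!: span_mono)
  next
    case (eng h1 h2)
    have "generate W J \<subseteq> carrier W"
      using J S_subset by (intro generate_incl) blast
    then have "h1 \<in> carrier W" "h2 \<in> carrier W"
      using eng by auto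
    then have "moved (h1 \<otimes> h2) \<subseteq> {a + b | a b. a \<in> moved h1 \<and> b \<in> moved h2}"
      unfolding g_mult[OF \<open>h1 \<in> carrier W\<close> \<open>h2 \<in> carrier W\<close>] by (intro moved_space_comp_subset)
    moreover have "a + b \<in> span (e ` J)" if "a \<in> moved h1" "b \<in> moved h2" for a b
      using that eng.IH by (intro span_add) blast+
    ultimately show ?case
      by blast
  qed
next
  assume sub: "moved h \<subseteq> span (e ` J)"
  \<comment> \<open>A point of the chamber lying on the walls of \<open>J\<close> and on no others.
    It is orthogonal to \<open>moved h\<close>, so \<open>h\<close> fixes it, and its stabilizer is
    generated by \<open>J\<close>.\<close>
  obtain u where u: "\<And>s. s \<in> S \<Longrightarrow> u \<bullet> e s = (if s \<in> J then 0 else 1)"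
    using dual_vector[of "\<lambda>s. if s \<in> J then 0 else 1"] by blast
  then have "u \<in> chamber"
    by (auto simp: chamber_def)
  have "orthogonal u x" if "x \<in> span (e ` J)" for x
    using that by (rule orthogonal_to_span) (use u J in \<open>auto simp: orthogonal_def\<close>)
  then have "g h u = u"
    using orthogonal_transformation_fixed_iff[OF orthogonal_g[OF h]] sub
    by (auto simp: orthogonal_def)
  then have "h \<in> generate W {s \<in> S. u \<bullet> e s = 0}"
    using chamber_fundamental[OF h \<open>u \<in> chamber\<close>] \<open>u \<in> chamber\<close> by simp
  also have "{s \<in> S. u \<bullet> e s = 0} = J"
    using u J by (auto split: if_splits)
  finally show "h \<in> generate W J" .
qed

text \<open>Conjugation by \<open>x\<close> carries the description of standard parabolic subgroups
  over to \<open>H\<close>, with \<open>U\<close>, the span of the vectors \<open>g x (e j)\<close>,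
  as the bounding subspace. It remains to identify \<open>U\<close> with \<open>Z\<close>.\<close>

lemma parabolic_eq:
  assumes "parabolic W S H"
  defines "Z \<equiv> span {\<alpha> \<in> \<Phi>. \<exists>h\<in>H. g h = reflection \<alpha>}"
  shows "H = {h \<in> carrier W. moved h \<subseteq> Z}"
proof -
  obtain x J where x: "x \<in> carrier W" and J: "J \<subseteq> S"
    and H: "H = x <# generate W J #> inv x"
    using assms(1) unfolding parabolic_def by blast
  define U where "U = span (g x ` e ` J)"
  have U: "U = g x ` span (e ` J)"
    unfolding U_def by (rule linear_span_image[OF linear_g[OF x]])
  have gen: "generate W J \<subseteq> carrier W"
    using J S_subset by (intro generate_incl) blast
  have mem: "h \<in> H \<longleftrightarrow> (\<exists>y\<in>generate W J. h = x \<otimes> y \<otimes> inv x)" for h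
    by (auto simp: H l_coset_def r_coset_def)
  have H_eq: "h \<in> H \<longleftrightarrow> h \<in> carrier W \<and> moved h \<subseteq> U" for h
  proof
    assume "h \<in> H"
    then obtain y where y: "y \<in> generate W J" "h = x \<otimes> y \<otimes> inv x"
      using mem by blast
    then have yc: "y \<in> carrier W"
      using gen by blast
    then have "moved h = g x ` moved y"
      using y x moved_conj by simp
    moreover have "moved y \<subseteq> span (e ` J)"
      using mem_standard_parabolic_iff[OF J yc] y by simp
    ultimately show "h \<in> carrier W \<and> moved h \<subseteq> U"
      using x y yc unfolding U by auto
  next
    assume h: "h \<in> carrier W \<and> moved h \<subseteq> U"
    define y where "y = inv x \<otimes> h \<otimes> inv (inv x)"
    have yc: "y \<in> carrier W"
      using x h by (simp add: y_def)
    have "moved y = g (inv x) ` moved h"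
      unfolding y_def using x h by (intro moved_conj) auto
    also have "\<dots> \<subseteq> g (inv x) ` g x ` span (e ` J)"
      using h unfolding U by (intro image_mono) auto
    also have "\<dots> = span (e ` J)"
      using x by (simp add: image_image)
    finally have "y \<in> generate W J"
      using mem_standard_parabolic_iff[OF J yc] by simp
    moreover have "x \<otimes> (inv x \<otimes> h) = h"
      using x h by (simp add: m_assoc[symmetric])
    then have "h = x \<otimes> y \<otimes> inv x"
      using x h unfolding y_def by (simp add: m_assoc)
    ultimately show "h \<in> H"
      using mem by blast
  qed
  have "Z = U"
  proof
    have "\<alpha> \<in> U" if \<alpha>: "\<alpha> \<in> \<Phi>" "h \<in> H" "g h = reflection \<alpha>" for \<alpha> h
    proof -
      have "moved h = span {\<alpha>}"
        using \<alpha> root_nonzero by (simp add: moved_space_reflection)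
      moreover have "\<alpha> \<in> span {\<alpha>}"
        by (rule span_base) simp
      ultimately show ?thesis
        using \<alpha>(2) H_eq[of h] by blast
    qed
    then have "{\<alpha> \<in> \<Phi>. \<exists>h\<in>H. g h = reflection \<alpha>} \<subseteq> U"
      by blast
    then show "Z \<subseteq> U"
      unfolding Z_def by (rule span_minimal) (simp add: U_def)
    have "g x (e j) \<in> Z" if j: "j \<in> J" for j
    proof -
      have jS: "j \<in> S"
        using j J by blast
      have inH: "x \<otimes> j \<otimes> inv x \<in> H"
        unfolding mem using generate.incl[OF j] by (rule bexI[rotated]) (rule refl)
      obtain \<alpha> where \<alpha>: "\<alpha> \<in> \<Phi>" "g (x \<otimes> j \<otimes> inv x) = reflection \<alpha>"
        using reflection_root[OF reflections_conj(1)[OF x jS]] by blast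
      \<comment> \<open>The vector \<open>g x (e j)\<close> may fail to be a root, but it defines
        the same reflection as the root \<open>\<alpha>\<close>, so both span the same line.\<close>
      have "g x (e j) \<noteq> 0"
        using inner_g[OF x, of "e j" "e j"] e_unit[OF jS] by auto
      then have "span {g x (e j)} = span {\<alpha>}"
        using \<alpha> reflections_conj(2)[OF x jS]
          moved_space_reflection[of "g x (e j)"] moved_space_reflection[OF root_nonzero[OF \<alpha>(1)]]
        by simp
      then have "g x (e j) \<in> span {\<alpha>}"
        using span_base[of "g x (e j)" "{g x (e j)}"] by simp
      also have "span {\<alpha>} \<subseteq> Z"
        unfolding Z_def using \<alpha> inH by (intro span_mono) auto
      finally show ?thesis .
    qed
    then have "g x ` e ` J \<subseteq> Z"
      by blast
    then show "U \<subseteq> Z"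
      unfolding U_def by (rule span_minimal) (simp add: Z_def)
  qed
  then show ?thesis
    using H_eq by blast
qed

end

section \<open>Modular elements of the root lattice\<close>

text \<open>The join is the sum of subspaces, so the dimension formula holds with the intersection
  in place of the meet. Modularity thus says that the meet, a subspace of the intersection, has the
  same dimension and so equals it.\<close>

lemma modular_element_root_lattice_iff:
  fixes Z :: "'v::euclidean_space set"
  assumes Z: "Z \<in> carrier (root_lattice \<Phi>)"
  shows "modular_element (root_lattice \<Phi>) dim Z \<longleftrightarrow>
    (\<forall>Y\<in>carrier (root_lattice \<Phi>). span (\<Phi> \<inter> Y \<inter> Z) = Y \<inter> Z)"
proof -
  interpret lattice "root_lattice \<Phi>"
    by (rule lattice_root_lattice)
  have "dim Y + dim Z = dim (Y \<sqinter>\<^bsub>root_lattice \<Phi>\<^esub> Z) + dim (Y \<squnion>\<^bsub>root_lattice \<Phi>\<^esub> Z)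
      \<longleftrightarrow> span (\<Phi> \<inter> Y \<inter> Z) = Y \<inter> Z"
    if Y: "Y \<in> carrier (root_lattice \<Phi>)" for Y
  proof -
    have sub: "subspace Y" "subspace Z"
      using Y Z by (auto simp: root_lattice_def)
    have meet: "Y \<sqinter>\<^bsub>root_lattice \<Phi>\<^esub> Z = span (\<Phi> \<inter> Y \<inter> Z)"
      unfolding meet_def inf_def using greatest_meet_root_lattice[OF Y Z] greatest_unique
      by (intro some_equality)
    have join: "Y \<squnion>\<^bsub>root_lattice \<Phi>\<^esub> Z = span (Y \<union> Z)"
      unfolding join_def sup_def using least_join_root_lattice[OF Y Z] least_unique
      by (intro some_equality)
    have "span (Y \<union> Z) = {x + y | x y. x \<in> Y \<and> y \<in> Z}"
      using sub by (simp only: span_Un span_eq_iff[THEN iffD2])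
    then have dims: "dim (span (Y \<union> Z)) + dim (Y \<inter> Z) = dim Y + dim Z"
      using dim_sums_Int[OF sub] by simp
    have "span (\<Phi> \<inter> Y \<inter> Z) \<subseteq> Y \<inter> Z"
      using sub by (intro span_minimal subspace_inter) auto
    then have "dim (span (\<Phi> \<inter> Y \<inter> Z)) = dim (Y \<inter> Z) \<longleftrightarrow> span (\<Phi> \<inter> Y \<inter> Z) = Y \<inter> Z"
      using subspace_dim_equal[OF subspace_span subspace_inter[OF sub]] by (metis order_refl)
    then show ?thesis
      unfolding meet join using dims by linarith
  qed
  then show ?thesis
    using Z by (simp add: modular_element_def)
qed

section \<open>Minimum elements of cosets in the absolute order\<close>

context finite_coxeter_roots
begin

text \<open>The quotient in the order relation is the conjugate of \<open>h\<close> by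
  \<open>m\<close>, which has the length of \<open>h\<close>. So the relation says that the lengths
  of \<open>m\<close> and \<open>h\<close> add up.\<close>

lemma absolute_le_iff_disjoint:
  assumes m: "m \<in> carrier W" and h: "h \<in> carrier W"
  shows "absolute_le W S m (m \<otimes> h) \<longleftrightarrow> moved m \<inter> moved h = {0}"
proof -
  have "absolute_le W S m (m \<otimes> h) \<longleftrightarrow> dim (moved (m \<otimes> h)) = dim (moved m) + dim (moved h)"
    using m h by (auto simp: absolute_le_def reflection_length_eq_dim_moved dim_moved_conj)
  also have "\<dots> \<longleftrightarrow> moved m \<inter> moved h = {0}"
  proof
    assume "dim (moved (m \<otimes> h)) = dim (moved m) + dim (moved h)"
    then have "dim (moved m \<inter> moved h) = 0"
      using dim_moved_space_comp_le[OF orthogonal_g orthogonal_g, OF m h]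
      unfolding g_mult[OF m h] by linarith
    then have "moved m \<inter> moved h \<subseteq> {0}"
      by simp
    then show "moved m \<inter> moved h = {0}"
      using subspace_0[OF subspace_moved] m h by blast
  next
    assume "moved m \<inter> moved h = {0}"
    then show "dim (moved (m \<otimes> h)) = dim (moved m) + dim (moved h)"
      unfolding g_mult[OF m h] by (intro dim_moved_space_comp_disjoint orthogonal_g m h)
  qed
  finally show ?thesis .
qed

lemma modular_subgroup_iff:
  assumes sub: "subgroup H W" and H: "H = {h \<in> carrier W. moved h \<subseteq> Z}"
    and Z: "Z \<in> carrier (root_lattice \<Phi>)"
  shows "modular_subgroup W S H \<longleftrightarrow>
    (\<forall>Y\<in>carrier (root_lattice \<Phi>). span (\<Phi> \<inter> Y \<inter> Z) = Y \<inter> Z)"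
proof
  assume mod: "modular_subgroup W S H"
  show "\<forall>Y\<in>carrier (root_lattice \<Phi>). span (\<Phi> \<inter> Y \<inter> Z) = Y \<inter> Z"
  proof
    fix Y assume Y: "Y \<in> carrier (root_lattice \<Phi>)"
    have ex: "\<exists>w\<in>carrier W. moved w = X" if X: "X \<in> carrier (root_lattice \<Phi>)" for X
    proof -
      obtain A where "A \<subseteq> \<Phi>" "X = span A"
        using X by (auto simp: root_lattice_def)
      then show ?thesis
        using ex_moved_eq_span by blast
    qed
    obtain w where w: "w \<in> carrier W" "moved w = Y"
      using ex[OF Y] by blast
    \<comment> \<open>The element \<open>c\<close> lies in \<open>H\<close> and its moved space is
      all of \<open>Z\<close>, so comparing \<open>m\<close> with \<open>m \<otimes> c\<close> alone
      gives \<open>moved m \<inter> Z = {0}\<close>.\<close>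
    obtain c where c: "c \<in> carrier W" "moved c = Z"
      using ex[OF Z] by blast
    have "w <# H \<in> lcosets H"
      using w by (auto simp: LCOSETS_def)
    then obtain m where m: "m \<in> w <# H" "\<And>x. x \<in> w <# H \<Longrightarrow> absolute_le W S m x"
      using mod unfolding modular_subgroup_def by blast
    obtain h0 where h0: "h0 \<in> H" "m = w \<otimes> h0"
      using m(1) by (auto simp: l_coset_def)
    have h0c: "h0 \<in> carrier W"
      using h0 H by blast
    have mc: "m \<in> carrier W"
      using h0 h0c w by simp
    have coset: "m \<otimes> h \<in> w <# H" if "h \<in> H" for h
      using that h0 h0c w H subgroup.m_closed[OF sub h0(1) that]
      by (auto simp: l_coset_def m_assoc)
    have disj: "moved m \<inter> moved h = {0}" if "h \<in> H" for h
      using m(2)[OF coset[OF that]] absolute_le_iff_disjoint[OF mc, of h] that H by blast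
    have "c \<in> H"
      using c H by blast
    then have mZ: "moved m \<inter> Z = {0}"
      using disj c by blast
    define h where "h = inv h0"
    have h: "h \<in> H"
      unfolding h_def by (rule subgroup.m_inv_closed[OF sub h0(1)])
    have hc: "h \<in> carrier W" and hZ: "moved h \<subseteq> Z"
      using h H by auto
    have "w = m \<otimes> h"
      using h0 h0c w by (simp add: h_def m_assoc)
    then have Y_eq: "Y = {a + b | a b. a \<in> moved m \<and> b \<in> moved h}"
      unfolding w(2)[symmetric]
      by (simp only: g_mult[OF mc hc])
        (rule moved_space_comp_disjoint[OF orthogonal_g orthogonal_g disj], (rule mc hc h)+)
    have subspaces: "subspace (moved m)" "subspace Z"
      using subspace_moved mc c by blast+
    \<comment> \<open>A vector of \<open>Y\<close> that lies in \<open>Z\<close> has its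
      \<open>moved m\<close> component in \<open>Z\<close> too, because
      \<open>moved h \<subseteq> Z\<close>; this component is therefore zero.\<close>
    have "moved h = Y \<inter> Z"
    proof
      show "moved h \<subseteq> Y \<inter> Z"
        using hZ subspace_0[OF subspaces(1)] by (force simp: Y_eq)
      show "Y \<inter> Z \<subseteq> moved h"
      proof
        fix v assume v: "v \<in> Y \<inter> Z"
        then obtain a b where ab: "v = a + b" "a \<in> moved m" "b \<in> moved h"
          unfolding Y_eq by blast
        have "v - b \<in> Z"
          using v ab hZ by (intro subspace_diff[OF subspaces(2)]) auto
        then have "a \<in> Z"
          using ab(1) by simp
        then have "a = 0"
          using ab(2) mZ by blast
        then show "v \<in> moved h"
          using ab by simp
      qed
    qed
    then show "span (\<Phi> \<inter> Y \<inter> Z) = Y \<inter> Z"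
      using moved_eq_span_roots[OF hc] by (simp add: Int_assoc)
  qed
next
  assume spanned: "\<forall>Y\<in>carrier (root_lattice \<Phi>). span (\<Phi> \<inter> Y \<inter> Z) = Y \<inter> Z"
  have "\<exists>m\<in>C. \<forall>x\<in>C. absolute_le W S m x" if "C \<in> lcosets H" for C
  proof -
    obtain a where a: "a \<in> carrier W" "C = a <# H"
      using \<open>C \<in> lcosets H\<close> by (auto simp: LCOSETS_def)
    have "a \<in> C"
      using a subgroup.one_closed[OF sub] by (force simp: l_coset_def)
    \<comment> \<open>A minimum for the absolute order must have least reflection length, so such an
      element is the candidate.\<close>
    then obtain m where m: "m \<in> C" "\<And>x. x \<in> C \<Longrightarrow> dim (moved m) \<le> dim (moved x)"
      using ex_has_least_nat[of "\<lambda>x. x \<in> C" a "\<lambda>x. dim (moved x)"] by blast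
    obtain h0 where h0: "h0 \<in> H" "m = a \<otimes> h0"
      using m(1) a by (auto simp: l_coset_def)
    have h0c: "h0 \<in> carrier W"
      using h0 H by blast
    have mc: "m \<in> carrier W"
      using h0 h0c a by simp
    have coset: "m \<otimes> h \<in> C" if "h \<in> H" for h
      using that h0 h0c a H subgroup.m_closed[OF sub h0(1) that]
      by (auto simp: l_coset_def m_assoc)
    \<comment> \<open>The reflection in such a root would lie in \<open>H\<close>, and multiplying
      \<open>m\<close> by it would give a shorter element of the same coset.\<close>
    have "\<Phi> \<inter> moved m \<inter> Z = {}"
    proof (rule ccontr)
      assume "\<Phi> \<inter> moved m \<inter> Z \<noteq> {}"
      then obtain \<alpha> where \<alpha>: "\<alpha> \<in> \<Phi>" "\<alpha> \<in> moved m" "\<alpha> \<in> Z"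
        by blast
      obtain t where t: "t \<in> reflections W S" "g t = reflection \<alpha>"
        using root_reflection[OF \<alpha>(1)] by blast
      have tc: "t \<in> carrier W"
        using t by (simp add: reflections_closed)
      have "subspace Z"
        using Z by (auto simp: root_lattice_def)
      then have "span {\<alpha>} \<subseteq> Z"
        using \<alpha> by (intro span_minimal) auto
      then have "t \<in> H"
        using tc t by (simp add: H moved_space_reflection root_nonzero \<alpha>)
      then have "dim (moved m) \<le> dim (moved (m \<otimes> t))"
        using m(2) coset by blast
      moreover have "Suc (dim (moved_space (g m \<circ> g t))) = dim (moved m)"
        unfolding t(2) using mc \<alpha> root_nonzero
        by (intro moved_space_comp_reflection_in orthogonal_g) auto
      ultimately show False
        unfolding g_mult[OF mc tc] by linarith
    qed
    moreover have "moved m \<in> carrier (root_lattice \<Phi>)"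
      using moved_eq_span_roots[OF mc] unfolding root_lattice_def by auto
    \<comment> \<open>As \<open>moved m\<close> belongs to the lattice, its intersection with
      \<open>Z\<close> is spanned by the roots it contains, and there are none.\<close>
    ultimately have mZ: "moved m \<inter> Z = {0}"
      using spanned by force
    have "absolute_le W S m x" if x: "x \<in> C" for x
    proof -
      obtain h1 where h1: "h1 \<in> H" "x = a \<otimes> h1"
        using x a by (auto simp: l_coset_def)
      define h where "h = inv h0 \<otimes> h1"
      have h: "h \<in> H"
        unfolding h_def by (intro subgroup.m_closed[OF sub] subgroup.m_inv_closed[OF sub] h0 h1)
      then have hc: "h \<in> carrier W" and "moved h \<subseteq> Z"
        using H by auto
      then have "moved m \<inter> moved h = {0}"
        using mZ subspace_0[OF subspace_moved] mc by blast
      moreover have "h1 \<in> carrier W"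
        using h1 H by blast
      then have "h0 \<otimes> (inv h0 \<otimes> h1) = h1"
        using h0c by (simp add: m_assoc[symmetric])
      then have "x = m \<otimes> h"
        using a h0 h0c hc h1 \<open>h1 \<in> carrier W\<close> by (simp add: h_def m_assoc)
      ultimately show ?thesis
        using absolute_le_iff_disjoint[OF mc hc] by simp
    qed
    then show ?thesis
      using m(1) by blast
  qed
  then show "modular_subgroup W S H"
    using sub by (simp add: modular_subgroup_def)
qed

end

section \<open>Extending the geometric representation to the ambient space\<close>

text \<open>Fixing the orthogonal complement of \<open>V\<close> pointwise makes the extension of a
  given map of \<open>V\<close> unique.\<close>

definition extension_on :: "'v::euclidean_space set \<Rightarrow> ('v \<Rightarrow> 'v) \<Rightarrow> bool"
  where "extension_on V f \<longleftrightarrow> orthogonal_transformation f \<and> f ` V \<subseteq> V \<and>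
    (\<forall>x. (\<forall>y\<in>V. x \<bullet> y = 0) \<longrightarrow> f x = x)"

lemma extension_on_id: "extension_on V (\<lambda>x. x)"
  by (simp add: extension_on_def)

lemma extension_on_comp: "\<lbrakk>extension_on V f; extension_on V h\<rbrakk> \<Longrightarrow> extension_on V (f \<circ> h)"
  by (auto simp: extension_on_def orthogonal_transformation_compose image_subset_iff)

lemma extension_on_reflection:
  assumes "subspace V" "\<alpha> \<in> V"
  shows "extension_on V (reflection \<alpha>)"
  using assms
  by (auto simp: extension_on_def orthogonal_transformation_reflection reflection_def
      intro!: subspace_diff subspace_scale)

lemma extension_on_unique:
  assumes "subspace V" "extension_on V f" "extension_on V h" "restrict f V = restrict h V"
  shows "f = h"
proof
  fix x
  obtain a b where ab: "a \<in> V" "\<And>w. w \<in> V \<Longrightarrow> orthogonal b w" "x = a + b"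
    using orthogonal_subspace_decomp_exists[of V x] span_eq_iff[THEN iffD2, OF assms(1)] by metis
  have "f a = h a"
    using ab(1) assms(4) by (metis restrict_apply')
  moreover have "f b = b" "h b = b"
    using assms ab(2) by (auto simp: extension_on_def orthogonal_def)
  moreover have "linear f" "linear h"
    using assms by (auto simp: extension_on_def orthogonal_transformation_linear)
  ultimately show "f x = h x"
    by (simp add: ab(3) linear_add)
qed

lemma ex_finite_coxeter_roots:
  fixes W :: "('a, 'b) monoid_scheme" and S :: "'a set"
    and V \<Phi> :: "'v::euclidean_space set"
    and e :: "'a \<Rightarrow> 'v" and \<rho> :: "'a \<Rightarrow> 'v \<Rightarrow> 'v"
  assumes "coxeter_system W S" and "finite (carrier W)"
    and "geometric_representation W S V e \<rho>"
    and "root_system_of W S V \<rho> \<Phi>"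
  shows "\<exists>g. finite_coxeter_roots W S e g \<Phi> \<and>
    (\<forall>w\<in>carrier W. \<forall>\<alpha>\<in>\<Phi>. \<rho> w = reflection_on V \<alpha> \<longleftrightarrow> g w = reflection \<alpha>)"
proof -
  have W: "group W" "S \<subseteq> carrier W" "generate W S = carrier W"
    and ord2: "\<And>s. s \<in> S \<Longrightarrow> group.ord W s = 2"
    using assms(1) by (auto simp: coxeter_system_def)
  interpret group W by (rule W(1))
  have e: "inj_on e S" "independent (e ` S)" "span (e ` S) = V"
    and gram: "\<And>s t. \<lbrakk>s \<in> S; t \<in> S\<rbrakk> \<Longrightarrow> e s \<bullet> e t = - cos (pi / real (ord (s \<otimes>\<^bsub>W\<^esub> t)))"
    and act: "faithful_action W V \<rho>"
    and \<rho>_S: "\<And>s. s \<in> S \<Longrightarrow> \<rho> s = reflection_on V (e s)"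
    using assms(3) by (auto simp: geometric_representation_def)
  interpret act: faithful_action W V \<rho> by (rule act)
  have \<Phi>: "finite \<Phi>" "0 \<notin> \<Phi>" "\<Phi> \<subseteq> V" and \<rho>_refl: "reflection_on V ` \<Phi> = \<rho> ` reflections W S"
    using assms(4) by (auto simp: root_system_of_def root_system_def)
  have V: "subspace V"
    unfolding e(3)[symmetric] by (rule subspace_span)
  have eV: "e s \<in> V" if "s \<in> S" for s
    unfolding e(3)[symmetric] using that by (intro span_base) simp
  have square: "s \<otimes>\<^bsub>W\<^esub> s = \<one>\<^bsub>W\<^esub>" if "s \<in> S" for s
    using that W(2) ord2[OF that] pow_ord_eq_1[of s] by (auto simp: numeral_2_eq_2)
  then have inv_S: "inv\<^bsub>W\<^esub> s = s" if "s \<in> S" for s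
    using that W(2) by (intro inv_equality) auto
  have \<rho>_one: "\<rho> \<one>\<^bsub>W\<^esub> = restrict (\<lambda>x. x) V"
    using act.id_eq_one by simp
  have \<rho>_mult: "\<rho> (x \<otimes>\<^bsub>W\<^esub> y) = compose V (\<rho> x) (\<rho> y)" if "x \<in> carrier W" "y \<in> carrier W" for x y
    using group_hom.hom_mult[OF act.group_hom that] act.bij_prop0 that by (simp add: BijGroup_def)
  have comp_restrict: "compose V (restrict f V) (restrict h V) = restrict (f \<circ> h) V"
    if "extension_on V h" for f h :: "'v \<Rightarrow> 'v"
    using that by (auto simp: extension_on_def compose_def fun_eq_iff)
  \<comment> \<open>Compose the reflections in the simple roots, which lie in \<open>V\<close>,
    along a word for \<open>w\<close>.\<close>
  have "\<exists>f. extension_on V f \<and> \<rho> w = restrict f V" if w: "w \<in> carrier W" for w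
  proof -
    obtain xs where xs: "xs \<in> lists S" "word_prod W xs = w"
      using generate_word[of S w] W inv_S w by auto
    from xs(1) have "\<exists>f. extension_on V f \<and> \<rho> (word_prod W xs) = restrict f V"
    proof (induction xs)
      case Nil
      then show ?case using extension_on_id \<rho>_one by auto
    next
      case (Cons s xs)
      then obtain f where f: "extension_on V f" "\<rho> (word_prod W xs) = restrict f V"
        unfolding Cons_in_lists_iff by blast
      have "s \<in> carrier W" "word_prod W xs \<in> carrier W"
        using Cons W(2) by (auto intro!: word_prod_closed)
      then have "\<rho> (word_prod W (s # xs)) = restrict (reflection (e s) \<circ> f) V"
        using Cons f \<rho>_S by (simp add: \<rho>_mult reflection_on_def comp_restrict)
      moreover have "extension_on V (reflection (e s) \<circ> f)"
        using Cons by (intro extension_on_comp f extension_on_reflection V eV) simp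
      ultimately show ?case by blast
    qed
    then show ?thesis using xs by simp
  qed
  then obtain g where g: "\<And>w. w \<in> carrier W \<Longrightarrow> extension_on V (g w)"
    and \<rho>_g: "\<And>w. w \<in> carrier W \<Longrightarrow> \<rho> w = restrict (g w) V"
    by metis
  have \<rho>_iff: "\<rho> w = reflection_on V \<alpha> \<longleftrightarrow> g w = reflection \<alpha>"
    if "w \<in> carrier W" "\<alpha> \<in> V" for w \<alpha>
    using that extension_on_unique[OF V g extension_on_reflection[OF V]] \<rho>_g
    by (auto simp: reflection_on_def)
  have refl_closed: "reflections W S \<subseteq> carrier W"
    using W(2) by (auto simp: reflections_def)
  have "finite_coxeter_roots W S e g \<Phi>"
  proof
    show "\<exists>u. \<forall>s\<in>S. u \<bullet> e s = f s" for f
    proof -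
      \<comment> \<open>By independence a linear functional takes the prescribed values on the
        simple roots; \<open>adjoint k 1\<close> is the vector representing it.\<close>
      obtain k :: "'v \<Rightarrow> real" where k: "linear k" "\<And>x. x \<in> e ` S \<Longrightarrow> k x = f (inv_into S e x)"
        using linear_independent_extend[OF e(2), of "\<lambda>x. f (inv_into S e x)"] by blast
      have "adjoint k 1 \<bullet> e s = f s" if "s \<in> S" for s
        unfolding inner_commute[of "adjoint k 1"] adjoint_works[OF k(1)]
        using that e(1) by (simp add: k(2))
      then show ?thesis by blast
    qed
    \<comment> \<open>Each \<open>g w\<close> was chosen separately; uniqueness of extensions makes
      the choices multiplicative.\<close>
    show "g (x \<otimes>\<^bsub>W\<^esub> y) = g x \<circ> g y" if "x \<in> carrier W" "y \<in> carrier W" for x y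
    proof (rule extension_on_unique[OF V])
      show "extension_on V (g (x \<otimes>\<^bsub>W\<^esub> y))" "extension_on V (g x \<circ> g y)"
        using that by (simp_all add: g extension_on_comp)
      have "restrict (g (x \<otimes>\<^bsub>W\<^esub> y)) V = compose V (\<rho> x) (\<rho> y)"
        unfolding \<rho>_mult[OF that, symmetric] using that by (intro \<rho>_g[symmetric] m_closed)
      also have "\<dots> = restrict (g x \<circ> g y) V"
        unfolding \<rho>_g[OF that(1)] \<rho>_g[OF that(2)] by (rule comp_restrict[OF g[OF that(2)]])
      finally show "restrict (g (x \<otimes>\<^bsub>W\<^esub> y)) V = restrict (g x \<circ> g y) V" .
    qed
    show "inj_on g (carrier W)"
      using act.faithful unfolding inj_on_def by (metis \<rho>_g)
    show "g s = reflection (e s)" if "s \<in> S" for s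
      using that \<rho>_iff[of s "e s"] \<rho>_S eV W(2) by auto
    show "\<exists>t\<in>reflections W S. g t = reflection \<alpha>" if "\<alpha> \<in> \<Phi>" for \<alpha>
    proof -
      have "reflection_on V \<alpha> \<in> \<rho> ` reflections W S"
        using \<rho>_refl that by blast
      then obtain t where "t \<in> reflections W S" "\<rho> t = reflection_on V \<alpha>"
        by auto
      then show ?thesis
        using \<rho>_iff[of t \<alpha>] that \<Phi>(3) refl_closed by blast
    qed
    show "\<exists>\<alpha>\<in>\<Phi>. g t = reflection \<alpha>" if "t \<in> reflections W S" for t
    proof -
      have "\<rho> t \<in> reflection_on V ` \<Phi>"
        using \<rho>_refl that by blast
      then obtain \<alpha> where "\<alpha> \<in> \<Phi>" "\<rho> t = reflection_on V \<alpha>"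
        by auto
      then show ?thesis
        using \<rho>_iff[of t \<alpha>] that \<Phi>(3) refl_closed by blast
    qed
  qed (use assms(2) W gram square g \<Phi> in \<open>auto simp: extension_on_def\<close>)
  then show ?thesis
    using \<rho>_iff \<Phi>(3) by blast
qed

theorem theorem3p9:
  fixes W :: "('a, 'b) monoid_scheme" and S H :: "'a set"
    and V \<Phi> :: "'v::euclidean_space set"
    and e :: "'a \<Rightarrow> 'v" and \<rho> :: "'a \<Rightarrow> 'v \<Rightarrow> 'v"
  assumes "coxeter_system W S" and "finite (carrier W)"
    and "geometric_representation W S V e \<rho>"
    and "root_system_of W S V \<rho> \<Phi>"
    and "reflection_subgroup W S H" and "parabolic W S H"
  shows "modular_subgroup W S H \<longleftrightarrow>
    modular_element (root_lattice \<Phi>) dim (root_span V \<rho> \<Phi> H)"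
proof -
  obtain g where "finite_coxeter_roots W S e g \<Phi>"
    and g: "\<And>w \<alpha>. \<lbrakk>w \<in> carrier W; \<alpha> \<in> \<Phi>\<rbrakk> \<Longrightarrow> \<rho> w = reflection_on V \<alpha> \<longleftrightarrow> g w = reflection \<alpha>"
    using ex_finite_coxeter_roots[OF assms(1-4)] by blast
  then interpret finite_coxeter_roots W S e g \<Phi> by simp
  obtain R where "R \<subseteq> reflections W S" "H = generate W R"
    using assms(5) by (auto simp: reflection_subgroup_def)
  then have sub: "subgroup H W"
    using reflections_closed by (auto intro!: generate_is_subgroup)
  \<comment> \<open>This identifies \<open>root_span\<close> with the span \<open>Z\<close> of
    \<open>parabolic_eq\<close>, which is phrased with the extensions \<open>g h\<close>.\<close>
  have "reflection_on V \<alpha> = \<rho> h \<longleftrightarrow> g h = reflection \<alpha>" if "h \<in> H" "\<alpha> \<in> \<Phi>" for h \<alpha>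
    using g[OF subgroup.mem_carrier[OF sub that(1)] that(2)] by metis
  then have "{\<alpha> \<in> \<Phi>. reflection_on V \<alpha> \<in> \<rho> ` H} = {\<alpha> \<in> \<Phi>. \<exists>h\<in>H. g h = reflection \<alpha>}"
    unfolding image_iff by blast
  then have Z: "root_span V \<rho> \<Phi> H = span {\<alpha> \<in> \<Phi>. \<exists>h\<in>H. g h = reflection \<alpha>}"
    by (simp add: root_span_def)
  then have mem: "root_span V \<rho> \<Phi> H \<in> carrier (root_lattice \<Phi>)"
    by (auto simp: root_lattice_def)
  show ?thesis
    unfolding modular_element_root_lattice_iff[OF mem]
    using parabolic_eq[OF assms(6)] unfolding Z[symmetric]
    by (intro modular_subgroup_iff sub mem)
qed

end
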